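(* Let $G$ be a simple graph, let $\beta,\gamma$ be real numbers and $H(G)=\beta D(G)+\gamma A(G)$. Let $k$ be an integer. (i) For every vertex $v$ of $G$, \begin{eqnarray*} d_k(H(G)) &=& \beta d(v)[d_{k-1}(H_v(G)) + d_k(H_v(G))] \\ && + \gamma^2 \sum_{u\in N(v)} [d_{k-2}(H_{uv}(G)) - d_k(H_{uv}(G))] \\ && +2 \sum_{C\in \mathfrak{C}_G(v)} \gamma^{|V(C)|}[d_{k-|V(C)|}(H_{V(C)}(G)) -(-1)^{|V(C)|}d_k(H_{V(C)}(G))]. \end{eqnarray*} (ii) For every edge $e=uv$ of $G$, \begin{eqnarray*} d_k(H(G)) &=& d_k(H(G-e)) + \beta[d_k(H_v(G-e)) + d_{k-1}(H_v(G-e))] \\ && + \beta[d_k(H_u(G-e)) + d_{k-1}(H_u(G-e))] \\ && +[(\beta^2 - \gamma^2)d_k(H_{uv}(G)) + 2\beta^2 d_{k-1}(H_{uv}(G)) + (\beta^2 + \gamma^2)d_{k-2}(H_{uv}(G))] \\ && +2 \sum_{C\in \mathfrak{C}_G(e)} \gamma^{|V(C)|}[d_{k-|V(C)|}(H_{V(C)}(G)) - (-1)^{|V(C)|}d_k(H_{V(C)}(G))]. \end{eqnarray*}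
   Context: For an $m\times m$ matrix $M=(m_{ij})$ and an integer $j$ with $1\le j\le m$, the hook immanant is $d_j(M)=\sum_{\sigma\in S_m}\chi_{(j,1^{m-j})}(\sigma)\prod_{i=1}^m m_{i\sigma(i)}$, where $\chi_{(j,1^{m-j})}$ is the irreducible character of $S_m$ indexed by the hook partition $(j,1^{m-j})$; by convention $d_j(M)=0$ if $j<1$ or $j>m$. For a simple graph $G$, $D(G)$ is the diagonal degree matrix and $A(G)$ the adjacency matrix; $H(G)=\beta D(G)+\gamma A(G)$. For $S\subseteq V(G)$, $H_S(G)$ is the principal submatrix of $H(G)$ obtained by deleting the rows and columns indexed by $S$; $H_v=H_{\{v\}}$, $H_{uv}=H_{\{u,v\}}$. $N(v)$ is the neighbourhood and $d(v)$ the degree of $v$ in $G$; $G-e$ is $G$ with edge $e$ deleted. $\mathfrak{C}_G(v)$ (resp. $\mathfrak{C}_G(e)$) is the set of cycles of $G$ containing $v$ (resp. $e$), each counted once; $|V(C)|$ is the number of vertices of $C$.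
   Formalization: For the empty (0×0) matrix, d_j is taken as 0 for j<1 and (-1)^(j-1) for j≥1 instead of 0 for all j; with the value 0 the formulas fail, e.g. (i) for K_2 with k=1 and γ≠0. *)

theory Defs
  imports Complex_Main "HOL-Combinatorics.Permutations" "HOL-Library.Function_Algebras"
begin

section \<open>Irreducible characters of symmetric groups\<close>

definition fscale :: "real \<Rightarrow> ('b \<Rightarrow> real) \<Rightarrow> 'b \<Rightarrow> real" where
  "fscale c f = (\<lambda>x. c * f x)"

global_interpretation fun_space: vector_space "fscale :: real \<Rightarrow> ('b \<Rightarrow> real) \<Rightarrow> 'b \<Rightarrow> real"
  by unfold_locales (auto simp: fscale_def fun_eq_iff algebra_simps)

definition trace_on :: "('b \<Rightarrow> real) set \<Rightarrow> (('b \<Rightarrow> real) \<Rightarrow> 'b \<Rightarrow> real) \<Rightarrow> real" where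
  "trace_on W T =
    (let B = (SOME B. B \<subseteq> W \<and> fun_space.independent B \<and> fun_space.span B = W)
     in \<Sum>b\<in>B. fun_space.representation B (T b) b)"

text \<open>
  The irreducible representation of the symmetric group on a finite set \<open>I\<close> indexed by a
  partition \<open>l\<close> of \<open>card I\<close> (a weakly decreasing list of positive parts) is the Specht module,
  spanned by the polytabloids of all tableaux of shape \<open>l\<close> with entries in \<open>I\<close>. A tabloid
  is recorded as the list of the row sets of a tableau. Specht modules are defined over the
  rationals, so the real Specht module has the same character as the complex one.
\<close>

definition cells :: "nat list \<Rightarrow> (nat \<times> nat) set" where
  "cells l = {(r, c). r < length l \<and> c < l ! r}"

definition tableau :: "'a set \<Rightarrow> nat list \<Rightarrow> (nat \<times> nat \<Rightarrow> 'a) \<Rightarrow> bool" where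
  "tableau I l t \<longleftrightarrow> bij_betw t (cells l) I"

definition tabloid :: "nat list \<Rightarrow> (nat \<times> nat \<Rightarrow> 'a) \<Rightarrow> 'a set list" where
  "tabloid l t = map (\<lambda>r. {t (r, c) | c. c < l ! r}) [0..<length l]"

definition column_stabilizer :: "'a set \<Rightarrow> nat list \<Rightarrow> (nat \<times> nat \<Rightarrow> 'a) \<Rightarrow> ('a \<Rightarrow> 'a) set" where
  "column_stabilizer I l t =
    {p. p permutes I \<and> (\<forall>r c. (r, c) \<in> cells l \<longrightarrow> (\<exists>r'. (r', c) \<in> cells l \<and> p (t (r, c)) = t (r', c)))}"

definition polytabloid :: "'a set \<Rightarrow> nat list \<Rightarrow> (nat \<times> nat \<Rightarrow> 'a) \<Rightarrow> 'a set list \<Rightarrow> real" where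
  "polytabloid I l t =
    (\<lambda>T. \<Sum>p\<in>column_stabilizer I l t. of_int (sign p) * (if T = tabloid l (p \<circ> t) then 1 else 0))"

definition specht :: "'a set \<Rightarrow> nat list \<Rightarrow> ('a set list \<Rightarrow> real) set" where
  "specht I l = fun_space.span {polytabloid I l t | t. tableau I l t}"

definition perm_act :: "('a \<Rightarrow> 'a) \<Rightarrow> ('a set list \<Rightarrow> real) \<Rightarrow> 'a set list \<Rightarrow> real" where
  "perm_act p f = (\<lambda>T. f (map ((`) (inv p)) T))"

definition irr_char :: "'a set \<Rightarrow> nat list \<Rightarrow> ('a \<Rightarrow> 'a) \<Rightarrow> real" where
  "irr_char I l p = trace_on (specht I l) (perm_act p)"

section \<open>Hook immanants\<close>

text \<open>
  A square matrix is given by its finite index set \<open>I\<close> and its entries, so deleting the rows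
  and columns in \<open>S\<close> replaces \<open>I\<close> by \<open>I - S\<close>.

  The number 0 has no hook partition, so the empty matrix needs a convention of its own.
  The vanishing of \<open>d\<^sub>j\<close> for \<open>j < 1\<close> is kept. The values for \<open>j \<ge> 1\<close> are the only ones for
  which the expansion along a vertex holds for the complete graph on 2 vertices, where the
  empty principal submatrix occurs. They are also the coefficients of \<open>q / (1 + q)\<close>,
  the case of the empty cycle type in
  \<open>(\<Sum>j. \<chi>\<^sub>j(\<mu>) q^j) = q / (1 + q) * (\<Prod>i. q^\<mu>\<^sub>i - (-1)^\<mu>\<^sub>i)\<close>.
\<close>

definition hook_immanant :: "int \<Rightarrow> 'a set \<Rightarrow> ('a \<Rightarrow> 'a \<Rightarrow> real) \<Rightarrow> real" where
  "hook_immanant j I M =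
    (if j < 1 then 0
     else if I = {} then (-1) ^ (nat j - 1)
     else if j > int (card I) then 0
     else \<Sum>p | p permutes I.
       irr_char I (nat j # replicate (card I - nat j) 1) p * (\<Prod>i\<in>I. M i (p i)))"

section \<open>Graphs\<close>

definition simple_graph :: "'a set \<Rightarrow> 'a set set \<Rightarrow> bool" where
  "simple_graph V E \<longleftrightarrow> finite V \<and> (\<forall>e\<in>E. e \<subseteq> V \<and> card e = 2)"

definition neighbourhood :: "'a set set \<Rightarrow> 'a \<Rightarrow> 'a set" where
  "neighbourhood E v = {u. {u, v} \<in> E}"

definition degree :: "'a set set \<Rightarrow> 'a \<Rightarrow> nat" where
  "degree E v = card (neighbourhood E v)"

definition degree_matrix :: "'a set set \<Rightarrow> 'a \<Rightarrow> 'a \<Rightarrow> real" where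
  "degree_matrix E u v = (if u = v then real (degree E u) else 0)"

definition adjacency_matrix :: "'a set set \<Rightarrow> 'a \<Rightarrow> 'a \<Rightarrow> real" where
  "adjacency_matrix E u v = (if {u, v} \<in> E then 1 else 0)"

definition H_matrix :: "real \<Rightarrow> real \<Rightarrow> 'a set set \<Rightarrow> 'a \<Rightarrow> 'a \<Rightarrow> real" where
  "H_matrix \<beta> \<gamma> E u v = \<beta> * degree_matrix E u v + \<gamma> * adjacency_matrix E u v"

text \<open>A cycle is its set of edges \<open>C\<close>, which counts it once regardless of starting point and
  orientation; its vertex set is \<open>\<Union>C\<close>.\<close>

definition is_cycle :: "'a set set \<Rightarrow> bool" where
  "is_cycle C \<longleftrightarrow> (\<exists>vs. length vs \<ge> 3 \<and> distinct vs \<and>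
     C = {{vs ! i, vs ! (Suc i mod length vs)} | i. i < length vs})"

definition cycles :: "'a set set \<Rightarrow> 'a set set set" where
  "cycles E = {C. C \<subseteq> E \<and> is_cycle C}"

definition cycles_through_vertex :: "'a set set \<Rightarrow> 'a \<Rightarrow> 'a set set set" where
  "cycles_through_vertex E v = {C \<in> cycles E. v \<in> \<Union>C}"

definition cycles_through_edge :: "'a set set \<Rightarrow> 'a set \<Rightarrow> 'a set set set" where
  "cycles_through_edge E e = {C \<in> cycles E. e \<in> C}"

end

theory Submission
  imports Defs "HOL-Combinatorics.Orbits"
begin

text \<open>
  Fix a point \<open>x\<close> of \<open>I\<close>. The Specht module of the hook with \<open>r\<close> cells below the first row consists
  of the boundaries in the \<open>r\<close>-th exterior power of the permutation module, and the boundaries of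
  \<open>x \<and> S\<close>, for \<open>r\<close>-subsets \<open>S\<close> of \<open>I - {x}\<close>, form a basis whose dual basis is evaluation at \<open>S\<close>.
  This gives the character as a signed count of the sets \<open>S\<close> that a permutation maps into
  \<open>insert x S\<close>. Choosing \<open>x\<close> outside a given cycle \<open>C\<close> of the permutation, such an \<open>S\<close> contains \<open>C\<close>
  or avoids it, whence the Murnaghan-Nakayama rule
  \<open>\<chi>\<^sub>j(p) = \<chi>\<^sub>j\<^sub>-\<^sub>L(p') - (-1)^L \<chi>\<^sub>j(p')\<close>, where \<open>p'\<close> is \<open>p\<close> without the cycle \<open>C\<close> of length \<open>L\<close>.

  Sorting the permutations by their cycle through a vertex \<open>v\<close> expands the immanant of any matrix
  along \<open>v\<close>. For \<open>H(G)\<close> the cycles of length 1, 2 and at least 3 contribute the three groups of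
  terms in (i). For (ii), the diagonal entries at \<open>u\<close> and \<open>v\<close> are changed one at a time, and then the
  expansions along \<open>v\<close> with and without the edge are compared.
\<close>

section \<open>Traces on function spaces\<close>

lemma sum_fun_apply: "(\<Sum>k\<in>K. f k) x = (\<Sum>k\<in>K. f k x)"
  for f :: "'k \<Rightarrow> 'b \<Rightarrow> 'c::comm_monoid_add"
  by (induction K rule: infinite_finite_induct) auto

text \<open>Evaluation at \<open>pt k\<close> gives the coefficient of a vector along
  \<open>b k\<close>. Expanding \<open>T a\<close> along the \<open>b k\<close>, then each
  \<open>b k\<close> in the chosen basis, and exchanging the two sums moves the trace from the basis
  to the family \<open>b\<close>; this is tr(XY) = tr(YX) for the two coordinate changes.\<close>

lemma trace_on_frame:
  fixes b :: "'k \<Rightarrow> 'b \<Rightarrow> real" and pt :: "'k \<Rightarrow> 'b"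
  assumes "finite K" and W: "fun_space.subspace W"
    and b: "\<And>k. k \<in> K \<Longrightarrow> b k \<in> W"
    and expand: "\<And>f. f \<in> W \<Longrightarrow> f = (\<Sum>k\<in>K. fscale (f (pt k)) (b k))"
    and T: "module_hom fscale fscale T" and TW: "\<And>f. f \<in> W \<Longrightarrow> T f \<in> W"
  shows "trace_on W T = (\<Sum>k\<in>K. T (b k) (pt k))"
proof -
  interpret T: module_hom fscale fscale T by (rule T)
  define B where "B = (SOME B. B \<subseteq> W \<and> fun_space.independent B \<and> fun_space.span B = W)"
  \<comment> \<open>\<open>trace_on\<close> picks its basis by \<open>SOME\<close>, so a basis must
    be exhibited before anything is known about the chosen one.\<close>
  obtain B0 where "B0 \<subseteq> W" "fun_space.independent B0" "W \<subseteq> fun_space.span B0"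
    using fun_space.maximal_independent_subset .
  then have "B0 \<subseteq> W \<and> fun_space.independent B0 \<and> fun_space.span B0 = W"
    using W fun_space.span_minimal by blast
  then have "B \<subseteq> W \<and> fun_space.independent B \<and> fun_space.span B = W"
    unfolding B_def by (rule someI)
  then have BW: "B \<subseteq> W" and ind: "fun_space.independent B" and span: "fun_space.span B = W"
    by auto
  have "W \<subseteq> fun_space.span (b ` K)"
  proof
    fix f assume "f \<in> W"
    have "(\<Sum>k\<in>K. fscale (f (pt k)) (b k)) \<in> fun_space.span (b ` K)"
      by (intro fun_space.span_sum fun_space.span_scale fun_space.span_base) auto
    then show "f \<in> fun_space.span (b ` K)" using expand[OF \<open>f \<in> W\<close>] by simp
  qed
  \<comment> \<open>Over an infinite basis the sum in \<open>trace_on\<close> would default to 0;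
    the finite spanning family rules this out.\<close>
  then have fin: "finite B"
    using fun_space.independent_span_bound[of "b ` K" B] \<open>finite K\<close> BW ind by auto
  let ?R = "fun_space.representation B"
  have "trace_on W T = (\<Sum>a\<in>B. ?R (T a) a)"
    by (simp add: trace_on_def B_def Let_def)
  also have "\<dots> = (\<Sum>a\<in>B. \<Sum>k\<in>K. T a (pt k) * ?R (b k) a)"
  proof (rule sum.cong[OF refl])
    fix a assume "a \<in> B"
    then have "T a \<in> W" using BW TW by auto
    have "?R (T a) = ?R (\<Sum>k\<in>K. fscale (T a (pt k)) (b k))"
      using expand[OF \<open>T a \<in> W\<close>] by simp
    also have "\<dots> = (\<lambda>c. \<Sum>k\<in>K. ?R (fscale (T a (pt k)) (b k)) c)"
      by (rule fun_space.representation_sum[OF ind])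
        (auto simp: span intro: fun_space.subspace_scale[OF W] b)
    finally show "?R (T a) a = (\<Sum>k\<in>K. T a (pt k) * ?R (b k) a)"
      using b by (simp add: fun_space.representation_scale[OF ind] span)
  qed
  also have "\<dots> = (\<Sum>k\<in>K. \<Sum>a\<in>B. T a (pt k) * ?R (b k) a)"
    by (rule sum.swap)
  also have "\<dots> = (\<Sum>k\<in>K. T (b k) (pt k))"
  proof (rule sum.cong[OF refl])
    fix k assume "k \<in> K"
    have "b k = (\<Sum>a\<in>B. fscale (?R (b k) a) a)"
      using fun_space.sum_representation_eq[OF ind, of "b k" B] b[OF \<open>k \<in> K\<close>] span fin by simp
    then have "T (b k) = (\<Sum>a\<in>B. fscale (?R (b k) a) (T a))"
      by (metis (no_types, lifting) T.scale T.sum sum.cong)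
    then show "(\<Sum>a\<in>B. T a (pt k) * ?R (b k) a) = T (b k) (pt k)"
      by (simp add: sum_fun_apply fscale_def mult.commute)
  qed
  finally show ?thesis .
qed

section \<open>Hook Specht modules\<close>

text \<open>A tabloid of hook shape is determined by the list of entries below its first row.\<close>

definition hook_tabloid :: "'a set \<Rightarrow> 'a list \<Rightarrow> 'a set list" where
  "hook_tabloid I xs = (I - set xs) # map (\<lambda>a. {a}) xs"

definition hook_polytabloid :: "'a set \<Rightarrow> 'a \<Rightarrow> 'a list \<Rightarrow> 'a set list \<Rightarrow> real" where
  "hook_polytabloid I a as =
    (\<lambda>T. \<Sum>p | p permutes insert a (set as). of_int (sign p) * of_bool (T = hook_tabloid I (map p as)))"

lemma hook_tabloid_eq_iff [simp]: "hook_tabloid I xs = hook_tabloid I ys \<longleftrightarrow> xs = ys"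
  by (auto simp: hook_tabloid_def inj_map_eq_map inj_on_def)

lemma cells_hook: "j \<ge> 1 \<Longrightarrow> cells (j # replicate r 1) = {0} \<times> {..<j} \<union> {1..r} \<times> {0}"
  by (auto simp: cells_def nth_Cons' split: if_splits)

lemma tabloid_hook:
  assumes t: "tableau I (j # replicate r 1) t" and "j \<ge> 1"
  shows "tabloid (j # replicate r 1) t = hook_tabloid I (map (\<lambda>i. t (i, 0)) [1..<Suc r])"
proof -
  have bij: "bij_betw t ({0} \<times> {..<j} \<union> {1..r} \<times> {0}) I"
    using t cells_hook[OF \<open>j \<ge> 1\<close>] by (simp add: tableau_def)
  have inj: "inj_on t ({0} \<times> {..<j} \<union> {1..r} \<times> {0})"
    using bij by (simp add: bij_betw_def)
  have im: "I = t ` ({0} \<times> {..<j}) \<union> t ` ({1..r} \<times> {0})"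
    using bij by (simp add: bij_betw_def image_Un)
  have disj: "t ` ({0} \<times> {..<j}) \<inter> t ` ({1..r} \<times> {0}) = {}"
  proof -
    have "{0} \<times> {..<j} \<inter> {1..r} \<times> {0} = {}" by auto
    then show ?thesis
      using inj_on_image_Int[OF inj, of "{0} \<times> {..<j}" "{1..r} \<times> {0}"] by simp
  qed
  have row: "{t (0, c) | c. c < j} = I - set (map (\<lambda>i. t (i, 0)) [1..<Suc r])"
  proof -
    have "{t (0, c) | c. c < j} = t ` ({0} \<times> {..<j})" by auto
    moreover have "set (map (\<lambda>i. t (i, 0)) [1..<Suc r]) = t ` ({1..r} \<times> {0})" by auto
    ultimately show ?thesis using im disj by auto
  qed
  have "tabloid (j # replicate r 1) t =
      {t (0, c) | c. c < j} # map (\<lambda>i. {t (i, c) | c. c < (j # replicate r 1) ! i}) [1..<Suc r]"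
    unfolding tabloid_def by (simp add: upt_conv_Cons del: upt_Suc)
  also have "map (\<lambda>i. {t (i, c) | c. c < (j # replicate r 1) ! i}) [1..<Suc r]
      = map (\<lambda>i. {t (i, 0)}) [1..<Suc r]"
    by (rule map_cong[OF refl]) (auto simp: nth_Cons')
  finally show ?thesis unfolding row hook_tabloid_def by (simp add: comp_def del: upt_Suc)
qed

text \<open>Every column but the first has a single cell, so a permutation preserving the columns
  fixes all entries outside the first column and may move those inside it freely.\<close>

lemma column_stabilizer_hook:
  assumes t: "tableau I (j # replicate r 1) t" and "j \<ge> 1"
  shows "column_stabilizer I (j # replicate r 1) t = {p. p permutes (\<lambda>i. t (i, 0)) ` {0..r}}"
    (is "?L = {p. p permutes ?A}")
proof -
  let ?l = "j # replicate r 1"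
  have cells: "cells ?l = {0} \<times> {..<j} \<union> {1..r} \<times> {0}" by (rule cells_hook[OF \<open>j \<ge> 1\<close>])
  have bij: "bij_betw t (cells ?l) I" using t by (simp add: tableau_def)
  have col: "(i, 0) \<in> cells ?l \<longleftrightarrow> i \<le> r" for i unfolding cells using \<open>j \<ge> 1\<close> by auto
  have AI: "?A \<subseteq> I" using bij col by (force simp: bij_betw_def)
  show ?thesis
  proof (intro equalityI subsetI; clarify)
    fix p assume p: "p \<in> ?L"
    then have perm: "p permutes I"
      and st: "\<And>r c. (r, c) \<in> cells ?l \<Longrightarrow> \<exists>r'. (r', c) \<in> cells ?l \<and> p (t (r, c)) = t (r', c)"
      by (auto simp: column_stabilizer_def)
    show "p permutes ?A"
    proof (rule permutes_superset[OF perm])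
      show "p x = x" if "x \<in> I - ?A" for x
      proof -
        from that bij obtain i c where ic: "(i, c) \<in> cells ?l" "x = t (i, c)"
          by (auto simp: bij_betw_def)
        then have "c \<noteq> 0" using that col by auto
        with ic have "i = 0" unfolding cells by auto
        from st[OF ic(1)] \<open>c \<noteq> 0\<close> show ?thesis using ic \<open>i = 0\<close> unfolding cells by auto
      qed
    qed
  next
    fix p assume p: "p permutes ?A"
    have "\<exists>r'. (r', c) \<in> cells ?l \<and> p (t (i, c)) = t (r', c)" if ic: "(i, c) \<in> cells ?l" for i c
    proof (cases "c = 0")
      case True
      then have "t (i, c) \<in> ?A" using col ic by auto
      then have "p (t (i, c)) \<in> ?A" using permutes_in_image[OF p] by simp
      then show ?thesis using True col by auto
    next
      case False
      have "t (i, c) \<notin> ?A"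
      proof
        assume "t (i, c) \<in> ?A"
        then obtain i' where "i' \<le> r" "t (i, c) = t (i', 0)" by auto
        then have "(i, c) = (i', 0)" using bij ic col by (auto simp: bij_betw_def inj_on_def)
        with False show False by simp
      qed
      then show ?thesis using ic permutes_not_in[OF p] by auto
    qed
    then show "p \<in> ?L" using permutes_subset[OF p AI] by (auto simp: column_stabilizer_def)
  qed
qed

lemma tableau_permute:
  assumes "tableau I l t" "p permutes I"
  shows "tableau I l (p \<circ> t)"
  using assms unfolding tableau_def by (meson bij_betw_trans permutes_imp_bij)

text \<open>Only the first column of the tableau matters: it determines the column stabilizer, and
  the first row of a tabloid is the complement of the entries below it.\<close>

lemma polytabloid_hook:
  assumes t: "tableau I (j # replicate r 1) t" and "j \<ge> 1"
  shows "polytabloid I (j # replicate r 1) t =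
    hook_polytabloid I (t (0, 0)) (map (\<lambda>i. t (i, 0)) [1..<Suc r])"
proof
  fix T
  let ?as = "map (\<lambda>i. t (i, 0)) [1..<Suc r]"
  have A: "insert (t (0, 0)) (set ?as) = (\<lambda>i. t (i, 0)) ` {0..r}"
  proof -
    have "{0..r} = insert 0 {1..<Suc r}" by auto
    then show ?thesis by (simp del: upt_Suc)
  qed
  have "tabloid (j # replicate r 1) (p \<circ> t) = hook_tabloid I (map p ?as)"
    if "p \<in> column_stabilizer I (j # replicate r 1) t" for p
  proof -
    have "p permutes I" using that by (simp add: column_stabilizer_def)
    from tabloid_hook[OF tableau_permute[OF t this] \<open>j \<ge> 1\<close>] show ?thesis by (simp add: comp_def)
  qed
  then show "polytabloid I (j # replicate r 1) t T = hook_polytabloid I (t (0, 0)) ?as T"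
    unfolding polytabloid_def hook_polytabloid_def A column_stabilizer_hook[OF t \<open>j \<ge> 1\<close>, symmetric]
    by (intro sum.cong) (auto simp: of_bool_def)
qed

text \<open>The first column is filled with \<open>a # as\<close>, and the other
  \<open>j - 1\<close> cells of the first row take the rest of \<open>I\<close> in any
  order.\<close>

lemma hook_tableau_exists:
  assumes "finite I" "distinct (a # as)" "set (a # as) \<subseteq> I"
    and "card I = j + r" "length as = r" "j \<ge> 1"
  obtains t where "tableau I (j # replicate r 1) t" "t (0, 0) = a"
    "map (\<lambda>i. t (i, 0)) [1..<Suc r] = as"
proof -
  have card: "card (set (a # as)) = Suc r"
    using distinct_card[OF assms(2)] assms(5) by simp
  have fin: "finite (I - set (a # as))" using assms(1) by simp
  have "card (I - set (a # as)) = j - 1"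
    using card_Diff_subset[of "set (a # as)" I] assms(3,4) card by simp
  then have "card (I - set (a # as)) = card ({0::nat} \<times> {1..<j})" by simp
  then obtain h where h: "bij_betw h ({0::nat} \<times> {1..<j}) (I - set (a # as))"
    using finite_same_card_bij[of "{0::nat} \<times> {1..<j}", OF _ fin] by (metis finite.emptyI finite.insertI finite_SigmaI finite_atLeastLessThan)
  define t where "t = (\<lambda>(i, c). if c = 0 then (a # as) ! i else h (i, c))"
  have "bij_betw (\<lambda>i. (a # as) ! i) {..<Suc r} (set (a # as))"
    by (rule bij_betw_nth) (use assms in auto)
  moreover have "bij_betw fst ({..r} \<times> {0::nat}) {..<Suc r}"
    by (auto simp: bij_betw_def inj_on_def image_iff)
  ultimately have "bij_betw ((\<lambda>i. (a # as) ! i) \<circ> fst) ({..r} \<times> {0::nat}) (set (a # as))"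
    using bij_betw_trans by blast
  then have 1: "bij_betw t ({..r} \<times> {0::nat}) (set (a # as))"
    by (rule iffD1[OF bij_betw_cong, rotated]) (auto simp: t_def)
  have 2: "bij_betw t ({0} \<times> {1..<j}) (I - set (a # as))"
    using h by (rule iffD1[OF bij_betw_cong, rotated]) (auto simp: t_def)
  have "bij_betw t ({..r} \<times> {0} \<union> {0} \<times> {1..<j}) (set (a # as) \<union> (I - set (a # as)))"
    by (rule bij_betw_combine[OF 1 2]) auto
  moreover have "{..r} \<times> {0} \<union> {0} \<times> {1..<j} = cells (j # replicate r 1)"
    unfolding cells_hook[OF \<open>j \<ge> 1\<close>] using \<open>j \<ge> 1\<close> by auto
  moreover have "set (a # as) \<union> (I - set (a # as)) = I" using assms(3) by auto
  ultimately have "tableau I (j # replicate r 1) t" by (simp add: tableau_def)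
  moreover have "t (0, 0) = a" by (simp add: t_def)
  moreover have "map (\<lambda>i. t (i, 0)) [1..<Suc r] = as"
    using assms(5) by (intro nth_equalityI) (auto simp: t_def simp del: upt_Suc)
  ultimately show ?thesis using that by blast
qed

definition hook_columns :: "'a set \<Rightarrow> nat \<Rightarrow> ('a \<times> 'a list) set" where
  "hook_columns I r = {(a, as). distinct (a # as) \<and> set (a # as) \<subseteq> I \<and> length as = r}"

lemma specht_hook:
  assumes "finite I" "card I = j + r" "j \<ge> 1"
  shows "specht I (j # replicate r 1) =
    fun_space.span ((\<lambda>(a, as). hook_polytabloid I a as) ` hook_columns I r)"
proof -
  have "{polytabloid I (j # replicate r 1) t | t. tableau I (j # replicate r 1) t} =
     (\<lambda>(a, as). hook_polytabloid I a as) ` hook_columns I r" (is "?L = ?R")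
  proof (intro equalityI subsetI)
    fix f assume "f \<in> ?L"
    then obtain t where t: "tableau I (j # replicate r 1) t"
      "f = polytabloid I (j # replicate r 1) t" by auto
    let ?as = "map (\<lambda>i. t (i, 0)) [1..<Suc r]"
    have eq: "t (0, 0) # ?as = map (\<lambda>i. t (i, 0)) [0..<Suc r]"
      by (simp add: upt_conv_Cons del: upt_Suc)
    have bij: "bij_betw t (cells (j # replicate r 1)) I" using t by (simp add: tableau_def)
    have sub: "(\<lambda>i. (i, 0)) ` {0..<Suc r} \<subseteq> cells (j # replicate r 1)"
      using \<open>j \<ge> 1\<close> unfolding cells_hook[OF \<open>j \<ge> 1\<close>] by auto
    then have "inj_on t ((\<lambda>i. (i, 0)) ` {0..<Suc r})"
      using bij by (meson bij_betw_def inj_on_subset)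
    then have "inj_on (t \<circ> (\<lambda>i. (i, 0))) {0..<Suc r}"
      by (intro comp_inj_on) (auto simp: inj_on_def)
    then have "distinct (t (0, 0) # ?as)"
      unfolding eq by (simp add: distinct_map comp_def del: upt_Suc)
    moreover have "set (t (0, 0) # ?as) \<subseteq> I"
      unfolding eq using sub bij by (auto simp: bij_betw_def simp del: upt_Suc)
    ultimately have "(t (0, 0), ?as) \<in> hook_columns I r"
      unfolding hook_columns_def by (simp del: upt_Suc)
    then show "f \<in> ?R" using t polytabloid_hook[OF t(1) \<open>j \<ge> 1\<close>] by force
  next
    fix f assume "f \<in> ?R"
    then obtain a as where aas: "distinct (a # as)" "set (a # as) \<subseteq> I" "length as = r"
      "f = hook_polytabloid I a as" by (auto simp: hook_columns_def)
    then obtain t where "tableau I (j # replicate r 1) t" "t (0, 0) = a"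
      "map (\<lambda>i. t (i, 0)) [1..<Suc r] = as"
      using hook_tableau_exists[of I a as j r] assms by blast
    then have "f = polytabloid I (j # replicate r 1) t" "tableau I (j # replicate r 1) t"
      using polytabloid_hook[of I j r t] aas \<open>j \<ge> 1\<close> by simp_all
    then show "f \<in> ?L" by blast
  qed
  then show ?thesis by (simp add: specht_def)
qed

section \<open>Alternating cycles and hook polytabloids\<close>

lemma obtain_permutes_map_eq:
  assumes "distinct xs" "distinct ys" "set xs = set ys"
  obtains q where "q permutes set xs" "map q xs = ys"
proof -
  have len: "length xs = length ys" using assms by (metis distinct_card)
  have lp: "list_permutes (zip xs ys) (set xs)"
    using assms len by (intro list_permutesI) (auto simp: set_zip_leftD map_fst_zip map_snd_zip)
  have "map (permutation_of_list (zip xs ys)) xs = ys"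
  proof (rule nth_equalityI)
    fix i assume "i < length (map (permutation_of_list (zip xs ys)) xs)"
    then have i: "i < length xs" by simp
    then have "map_of (zip xs ys) (xs ! i) = Some (ys ! i)"
      using assms len by (simp add: map_of_zip_nth)
    then show "map (permutation_of_list (zip xs ys)) xs ! i = ys ! i"
      using i by (simp add: permutation_of_list_def)
  qed (use len in simp)
  then show ?thesis using that permutation_of_list_permutes[OF lp] by blast
qed

text \<open>
  Identify a tabloid with the wedge product of the entries below its first row. A polytabloid is
  then the boundary of a simplex, and the last condition says that boundaries are cycles.
\<close>

definition hook_relations :: "'a set \<Rightarrow> nat \<Rightarrow> ('a set list \<Rightarrow> real) set" where
  "hook_relations I r = {f.
    (\<forall>T. f T \<noteq> 0 \<longrightarrow> (\<exists>xs. distinct xs \<and> set xs \<subseteq> I \<and> length xs = r \<and> T = hook_tabloid I xs)) \<and>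
    (\<forall>xs q. q permutes set xs \<longrightarrow> f (hook_tabloid I (map q xs)) = of_int (sign q) * f (hook_tabloid I xs)) \<and>
    (\<forall>ys. Suc (length ys) = r \<longrightarrow> (\<Sum>y\<in>I - set ys. f (hook_tabloid I (y # ys))) = 0)}"

lemma subspace_hook_relations: "fun_space.subspace (hook_relations I r)"
proof (rule fun_space.subspaceI)
  show "0 \<in> hook_relations I r" by (simp add: hook_relations_def)
next
  fix f g assume f: "f \<in> hook_relations I r" and g: "g \<in> hook_relations I r"
  have "\<exists>xs. distinct xs \<and> set xs \<subseteq> I \<and> length xs = r \<and> T = hook_tabloid I xs" if "f T + g T \<noteq> 0" for T
  proof -
    from that have "f T \<noteq> 0 \<or> g T \<noteq> 0" by auto
    then show ?thesis using f g unfolding hook_relations_def by blast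
  qed
  then show "f + g \<in> hook_relations I r"
    using f g by (simp add: hook_relations_def sum.distrib distrib_left)
next
  fix c f assume f: "f \<in> hook_relations I r"
  then show "fscale c f \<in> hook_relations I r"
    by (simp add: hook_relations_def fscale_def sum_distrib_left[symmetric] mult.left_commute)
qed

text \<open>Alternation comes from substituting \<open>q \<circ> p\<close> for \<open>p\<close> in
  the defining sum. In the boundary condition each \<open>p\<close> contributes for at most one
  \<open>y\<close>, and the contributions that remain cancel in pairs.\<close>

lemma hook_polytabloid_in_relations:
  assumes "finite I" "distinct (a # as)" "set (a # as) \<subseteq> I"
  shows "hook_polytabloid I a as \<in> hook_relations I (length as)"
proof -
  let ?A = "insert a (set as)" and ?f = "hook_polytabloid I a as"
  have fin: "finite ?A" by simp
  have perm: "permutation p" if "p permutes ?A" for p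
    using that permutation_permutes fin by blast
  have "\<exists>xs. distinct xs \<and> set xs \<subseteq> I \<and> length xs = length as \<and> T = hook_tabloid I xs"
    if "?f T \<noteq> 0" for T
  proof -
    obtain p where p: "p permutes ?A" "T = hook_tabloid I (map p as)"
      using \<open>?f T \<noteq> 0\<close> unfolding hook_polytabloid_def
      by (auto elim!: sum.not_neutral_contains_not_neutral)
    have "distinct (map p as)"
      using assms(2) permutes_inj[OF p(1)] by (simp add: distinct_map inj_on_def)
    moreover have "set (map p as) \<subseteq> p ` ?A" by auto
    then have "set (map p as) \<subseteq> I" using permutes_image[OF p(1)] assms(3) by auto
    ultimately show ?thesis using p(2) by auto
  qed
  moreover have "?f (hook_tabloid I (map q xs)) = of_int (sign q) * ?f (hook_tabloid I xs)"
    if q: "q permutes set xs" for xs q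
  proof (cases "set xs \<subseteq> ?A")
    case True
    have qA: "q permutes ?A" using permutes_subset[OF q True] .
    have inj: "inj q" using permutes_inj[OF q] .
    have "?f (hook_tabloid I (map q xs)) =
       (\<Sum>p | p permutes ?A. of_int (sign (q \<circ> p)) * of_bool (map q xs = map (q \<circ> p) as))"
      unfolding hook_polytabloid_def hook_tabloid_eq_iff
      by (rule setum_permutations_compose_left[OF qA])
    also have "\<dots> = (\<Sum>p | p permutes ?A. of_int (sign q) * (of_int (sign p) * of_bool (xs = map p as)))"
    proof (rule sum.cong[OF refl])
      fix p assume "p \<in> {p. p permutes ?A}"
      then have "sign (q \<circ> p) = sign q * sign p" using perm qA by (simp add: sign_compose)
      moreover have "map q xs = map (q \<circ> p) as \<longleftrightarrow> xs = map p as"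
        using inj by (metis inj_map_eq_map map_map)
      ultimately show "of_int (sign (q \<circ> p)) * of_bool (map q xs = map (q \<circ> p) as) =
        of_int (sign q) * (of_int (sign p) * of_bool (xs = map p as) :: real)" by simp
    qed
    finally show ?thesis unfolding hook_polytabloid_def by (simp add: sum_distrib_left)
  next
    \<comment> \<open>Since \<open>q\<close> preserves \<open>set xs\<close>, neither
      \<open>xs\<close> nor \<open>map q xs\<close> is an image of \<open>as\<close> under a column
      permutation, so both sides vanish.\<close>
    case False
    have ne: "xs \<noteq> map p as" "map q xs \<noteq> map p as" if "p permutes ?A" for p
    proof -
      have sub: "set (map p as) \<subseteq> ?A" using permutes_in_image[OF that] by auto
      have "set (map q xs) = set xs" using permutes_image[OF q] by simp
      then show "xs \<noteq> map p as" "map q xs \<noteq> map p as" using sub False by metis+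
    qed
    have "?f (hook_tabloid I (map q xs)) = 0" "?f (hook_tabloid I xs) = 0"
      unfolding hook_polytabloid_def hook_tabloid_eq_iff
      by (rule sum.neutral, rule ballI, use ne in simp)+
    then show ?thesis by simp
  qed
  moreover have "(\<Sum>y\<in>I - set ys. ?f (hook_tabloid I (y # ys))) = 0"
    if len: "Suc (length ys) = length as" for ys
  proof -
    obtain a1 rest where as: "as = a1 # rest" using len by (cases as) auto
    let ?g = "\<lambda>p. of_int (sign p) * of_bool (ys = map p rest) :: real"
    have "(\<Sum>y\<in>I - set ys. ?f (hook_tabloid I (y # ys))) =
       (\<Sum>p | p permutes ?A. \<Sum>y\<in>I - set ys. of_int (sign p) * of_bool (y # ys = map p as))"
      unfolding hook_polytabloid_def hook_tabloid_eq_iff by (rule sum.swap)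
    also have "\<dots> = (\<Sum>p | p permutes ?A. ?g p)"
    proof (rule sum.cong[OF refl])
      fix p assume "p \<in> {p. p permutes ?A}"
      then have p: "p permutes ?A" by simp
      show "(\<Sum>y\<in>I - set ys. of_int (sign p) * of_bool (y # ys = map p as)) = ?g p"
      proof (cases "ys = map p rest")
        case True
        have "p a1 \<notin> set (map p rest)"
          using assms(2) permutes_inj[OF p] as by (auto simp: inj_on_def)
        moreover have "p a1 \<in> I" using permutes_in_image[OF p, of a1] assms(3) as by auto
        ultimately have "p a1 \<in> I - set ys" using True by simp
        moreover have "of_int (sign p) * of_bool (y # ys = map p as) =
            (if y = p a1 then of_int (sign p) else 0 :: real)" for y
          using True as by auto
        ultimately show ?thesis using assms(1) True by simp
      qed (simp add: as)
    qed
    also have "\<dots> = 0"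
    proof -
      \<comment> \<open>\<open>rest\<close> contains neither \<open>a\<close> nor \<open>a1\<close>,
        so swapping these two first flips the sign of \<open>p\<close> and leaves
        \<open>map p rest\<close> unchanged.\<close>
      let ?t = "transpose a a1"
      have t: "?t permutes ?A" using as by (intro permutes_swap_id) auto
      have "(\<Sum>p | p permutes ?A. ?g p) = (\<Sum>p | p permutes ?A. ?g (p \<circ> ?t))"
        by (rule sum_permutations_compose_right[OF t])
      also have "\<dots> = (\<Sum>p | p permutes ?A. - ?g p)"
      proof (rule sum.cong[OF refl])
        fix p assume "p \<in> {p. p permutes ?A}"
        then have "sign (p \<circ> ?t) = - sign p"
          using perm[OF t] perm[of p] assms(2) as by (simp add: sign_compose sign_swap_id)
        moreover have "(ys = map (p \<circ> ?t) rest) = (ys = map p rest)"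
          by (rule arg_cong[where f = "\<lambda>zs. ys = zs"]) (use assms(2) as in \<open>auto simp: transpose_def\<close>)
        ultimately show "?g (p \<circ> ?t) = - ?g p" by simp
      qed
      finally show ?thesis by (simp add: sum_negf)
    qed
    finally show ?thesis .
  qed
  ultimately show ?thesis unfolding hook_relations_def by blast
qed

text \<open>An alternating cycle is determined by its values on simplices avoiding \<open>x\<close>:
  a list through \<open>x\<close> can be reordered to start with \<open>x\<close>, and the cycle
  condition for its tail then expresses its value by values at lists that avoid \<open>x\<close>.
  Together with the dual basis this shows that the polytabloids based at \<open>x\<close>
  span.\<close>

lemma hook_relations_eq_0:
  assumes "finite I" "x \<in> I" and f: "f \<in> hook_relations I r"
    and en: "\<And>S. S \<subseteq> I - {x} \<Longrightarrow> card S = r \<Longrightarrow> distinct (en S) \<and> set (en S) = S"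
    and 0: "\<And>S. S \<subseteq> I - {x} \<Longrightarrow> card S = r \<Longrightarrow> f (hook_tabloid I (en S)) = 0"
  shows "f = 0"
proof
  have supp: "\<exists>xs. distinct xs \<and> set xs \<subseteq> I \<and> length xs = r \<and> T = hook_tabloid I xs"
    if "f T \<noteq> 0" for T using f that unfolding hook_relations_def by blast
  have alt: "f (hook_tabloid I (map q xs)) = of_int (sign q) * f (hook_tabloid I xs)"
    if "q permutes set xs" for xs q using f that unfolding hook_relations_def by blast
  have cyc: "(\<Sum>y\<in>I - set ys. f (hook_tabloid I (y # ys))) = 0" if "Suc (length ys) = r" for ys
    using f that unfolding hook_relations_def by blast
  have same: "f (hook_tabloid I ys) = 0"
    if "distinct xs" "distinct ys" "set xs = set ys" "f (hook_tabloid I xs) = 0" for xs ys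
    using obtain_permutes_map_eq[OF that(1-3)] alt that(4) by (metis mult_zero_right)
  have avoid: "f (hook_tabloid I xs) = 0"
    if "distinct xs" "set xs \<subseteq> I - {x}" "length xs = r" for xs
  proof -
    have "card (set xs) = r" using that distinct_card by blast
    then show ?thesis using same[of "en (set xs)" xs] en[OF that(2)] 0[OF that(2)] that by auto
  qed
  fix T
  show "f T = 0 T"
  proof (rule ccontr)
    assume "f T \<noteq> 0 T"
    then obtain xs where xs: "distinct xs" "set xs \<subseteq> I" "length xs = r" "T = hook_tabloid I xs"
      and T: "f T \<noteq> 0"
      using supp[of T] by auto
    with avoid have "x \<in> set xs" by blast
    define ys where "ys = remove1 x xs"
    have ys: "distinct (x # ys)" "set (x # ys) = set xs"
      using xs \<open>x \<in> set xs\<close> by (auto simp: ys_def)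
    then have len: "Suc (length ys) = r" using xs distinct_card by (metis length_Cons)
    have "x \<in> I - set ys" using ys assms(2) by auto
    then have "(\<Sum>y\<in>I - set ys. f (hook_tabloid I (y # ys))) =
       f (hook_tabloid I (x # ys)) + (\<Sum>y\<in>(I - set ys) - {x}. f (hook_tabloid I (y # ys)))"
      using assms(1) by (intro sum.remove) auto
    moreover have "(\<Sum>y\<in>(I - set ys) - {x}. f (hook_tabloid I (y # ys))) = 0"
      using ys xs len by (intro sum.neutral ballI avoid) auto
    ultimately have "f (hook_tabloid I (x # ys)) = 0" using cyc[OF len] by simp
    then show False using same[OF ys(1) xs(1) ys(2)] T xs(4) by simp
  qed
qed

section \<open>The permutation action and its character\<close>

lemma image_hook_tabloid:
  assumes "p permutes I"
  shows "map ((`) p) (hook_tabloid I xs) = hook_tabloid I (map p xs)"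
  using image_set_diff[OF permutes_inj[OF assms], of I "set xs"] permutes_image[OF assms]
  by (simp add: hook_tabloid_def)

text \<open>Conjugation by \<open>p\<close> carries the symmetric group of the column
  \<open>a # as\<close> to that of its image and preserves signs.\<close>

lemma perm_act_hook_polytabloid:
  assumes fin: "finite I" and p: "p permutes I"
  shows "perm_act p (hook_polytabloid I a as) = hook_polytabloid I (p a) (map p as)"
proof
  fix T
  let ?A = "insert a (set as)"
  have A: "finite ?A" by simp
  have bij: "bij p" using p permutes_bij by blast
  have inj: "inj p" using bij bij_is_inj by blast
  have ins: "insert (p a) (set (map p as)) = p ` ?A" by simp
  have Teq: "map ((`) (inv p)) T = hook_tabloid I (map q as) \<longleftrightarrow>
      T = hook_tabloid I (map (p \<circ> q) as)" for q
  proof -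
    have 1: "map ((`) (inv p)) (hook_tabloid I (map (p \<circ> q) as)) = hook_tabloid I (map q as)"
      unfolding image_hook_tabloid[OF permutes_inv[OF p]] using permutes_inverses(2)[OF p] by (simp add: comp_def)
    have "inj (inv p)" using p permutes_inv permutes_inj by blast
    then have "inj (map ((`) (inv p)))" by (intro inj_mapI) (auto simp: inj_def inj_image_eq_iff)
    then show ?thesis using 1 by (metis injD)
  qed
  have "hook_polytabloid I (p a) (map p as) T = (\<Sum>q | q permutes ?A.
      of_int (sign (p \<circ> q \<circ> inv p)) * of_bool (T = hook_tabloid I (map (p \<circ> q \<circ> inv p) (map p as))))"
    unfolding hook_polytabloid_def ins
  proof (rule sum.reindex_bij_witness[of _ "\<lambda>q. p \<circ> q \<circ> inv p" "\<lambda>q. inv p \<circ> q \<circ> p"])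
    have pinv: "p (inv p y) = y" "inv p (p y) = y" for y using permutes_inverses[OF p] by auto
    show conj: "p \<circ> (inv p \<circ> q \<circ> p) \<circ> inv p = q" "inv p \<circ> (p \<circ> q \<circ> inv p) \<circ> p = q" for q
      by (simp_all add: fun_eq_iff pinv)
    show "inv p \<circ> q \<circ> p \<in> {q. q permutes ?A}" if "q \<in> {q. q permutes p ` ?A}" for q
    proof -
      have q: "q permutes p ` ?A" using that by simp
      have "bij (inv p \<circ> q \<circ> p)" using bij permutes_bij[OF q] by (intro bij_comp) (auto simp: bij_imp_bij_inv)
      moreover have "(inv p \<circ> q \<circ> p) y = y" if "y \<notin> ?A" for y
      proof -
        have "p y \<notin> p ` ?A" using that inj by (auto simp: inj_def)
        then show ?thesis using permutes_not_in[OF q] pinv by simp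
      qed
      ultimately have "inv p \<circ> q \<circ> p permutes ?A"
        unfolding permutes_def by (metis bij_pointE)
      then show ?thesis by simp
    qed
    show "p \<circ> q \<circ> inv p \<in> {q. q permutes p ` ?A}" if "q \<in> {q. q permutes ?A}" for q
    proof -
      have q: "q permutes ?A" using that by simp
      have "bij (p \<circ> q \<circ> inv p)" using bij permutes_bij[OF q] by (intro bij_comp) (auto simp: bij_imp_bij_inv)
      moreover have "(p \<circ> q \<circ> inv p) y = y" if "y \<notin> p ` ?A" for y
      proof -
        have "inv p y \<notin> ?A" using that pinv by (metis imageI)
        then show ?thesis using permutes_not_in[OF q] pinv by simp
      qed
      ultimately have "p \<circ> q \<circ> inv p permutes p ` ?A"
        unfolding permutes_def by (metis bij_pointE)
      then show ?thesis by simp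
    qed
    show "of_int (sign (p \<circ> (inv p \<circ> q \<circ> p) \<circ> inv p)) * of_bool (T = hook_tabloid I (map (p \<circ> (inv p \<circ> q \<circ> p) \<circ> inv p) (map p as)))
       = of_int (sign q) * (of_bool (T = hook_tabloid I (map q (map p as)))::real)" for q
      by (simp only: conj)
  qed
  also have "\<dots> = (\<Sum>q | q permutes ?A.
      of_int (sign q) * of_bool (map ((`) (inv p)) T = hook_tabloid I (map q as)))"
  proof (rule sum.cong[OF refl])
    fix q assume "q \<in> {q. q permutes ?A}"
    then have "permutation q" using A permutation_permutes by blast
    moreover have "permutation p" using fin p permutation_permutes by blast
    ultimately have "sign (p \<circ> q \<circ> inv p) = sign q"
      by (simp add: sign_compose sign_inverse permutation_compose permutation_inverse mult.commute mult.left_commute)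
    moreover have "map (p \<circ> q \<circ> inv p) (map p as) = map (p \<circ> q) as"
      using permutes_inverses[OF p] by simp
    ultimately show "of_int (sign (p \<circ> q \<circ> inv p)) * of_bool (T = hook_tabloid I (map (p \<circ> q \<circ> inv p) (map p as)))
      = of_int (sign q) * (of_bool (map ((`) (inv p)) T = hook_tabloid I (map q as)) :: real)"
      using Teq[of q] by (simp only:)
  qed
  finally show "perm_act p (hook_polytabloid I a as) T = hook_polytabloid I (p a) (map p as) T"
    by (simp add: perm_act_def hook_polytabloid_def)
qed

text \<open>The polytabloids with first column \<open>x # en S\<close> and the tabloids of
  \<open>en S\<close> form the frame for \<open>trace_on_frame\<close>, with \<open>en S\<close> an
  arbitrary enumeration of \<open>S\<close>. The inverse of \<open>p\<close> comes from
  \<open>perm_act\<close>, which evaluates at the tabloid moved by \<open>inv p\<close>;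
  \<open>\<pi>\<close> runs over the column permutations producing that tabloid.\<close>

lemma irr_char_hook:
  assumes fin: "finite I" and x: "x \<in> I" and card: "card I = j + r" and "j \<ge> 1"
    and p: "p permutes I"
  shows "irr_char I (j # replicate r 1) p =
    (\<Sum>S | S \<subseteq> I - {x} \<and> card S = r.
       \<Sum>\<pi> | \<pi> permutes insert x S \<and> (\<forall>s\<in>S. \<pi> s = inv p s). of_int (sign \<pi>))"
proof -
  let ?l = "j # replicate r 1"
  define W where "W = specht I ?l"
  define K where "K = {S. S \<subseteq> I - {x} \<and> card S = r}"
  define en where "en S = (SOME xs. distinct xs \<and> set xs = S)" for S :: "'a set"
  have en: "distinct (en S)" "set (en S) = S" if "finite S" for S
    using someI_ex[of "\<lambda>xs. distinct xs \<and> set xs = S"] finite_distinct_list[OF that]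
    unfolding en_def by blast+
  have finK: "finite K" using fin by (simp add: K_def)
  have Kfin: "finite S" if "S \<in> K" for S using that fin finite_subset by (fastforce simp: K_def)
  have len: "length (en S) = r" if "S \<in> K" for S
    using en[OF Kfin[OF that]] that distinct_card[of "en S"] by (simp add: K_def)
  define b where "b S = hook_polytabloid I x (en S)" for S
  define pt where "pt S = hook_tabloid I (en S)" for S
  have W: "W = fun_space.span ((\<lambda>(a, as). hook_polytabloid I a as) ` hook_columns I r)"
    unfolding W_def by (rule specht_hook[OF fin card \<open>j \<ge> 1\<close>])
  have sub: "fun_space.subspace W" unfolding W by (rule fun_space.subspace_span)
  have W_rel: "W \<subseteq> hook_relations I r"
    unfolding W
    by (rule fun_space.span_minimal[OF _ subspace_hook_relations])
      (auto simp: hook_columns_def intro!: hook_polytabloid_in_relations fin)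
  have bW: "b S \<in> W" if "S \<in> K" for S
    unfolding W b_def using that en[OF Kfin[OF that]] len[OF that] x
    by (intro fun_space.span_base image_eqI[of _ _ "(x, en S)"]) (auto simp: hook_columns_def K_def)
  have bval: "b S (hook_tabloid I (map g (en S'))) =
      (\<Sum>\<pi> | \<pi> permutes insert x S \<and> map \<pi> (en S) = map g (en S'). of_int (sign \<pi>))"
    if "S \<in> K" for S S' g
  proof -
    have "b S (hook_tabloid I (map g (en S'))) = (\<Sum>\<pi> | \<pi> permutes insert x S.
        of_int (sign \<pi>) * of_bool (map g (en S') = map \<pi> (en S)))"
      using en[OF Kfin[OF that]] unfolding b_def hook_polytabloid_def hook_tabloid_eq_iff by simp
    also have "\<dots> = (\<Sum>\<pi> | \<pi> permutes insert x S \<and> map \<pi> (en S) = map g (en S'). of_int (sign \<pi>))"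
      using Kfin[OF that] by (intro sum.mono_neutral_cong_right) (auto simp: finite_permutations)
    finally show ?thesis .
  qed
  \<comment> \<open>A column permutation taking \<open>en S\<close> to \<open>en S'\<close> forces
    \<open>S'\<close> into \<open>insert x S\<close>, hence into \<open>S\<close> because
    \<open>S'\<close> avoids \<open>x\<close>, hence \<open>S' = S\<close> by cardinality. It then
    fixes every element of \<open>S\<close>, and so \<open>x\<close> as well.\<close>
  have dual: "b S (pt S') = (if S = S' then 1 else 0)" if "S \<in> K" "S' \<in> K" for S S'
  proof -
    have "{\<pi>. \<pi> permutes insert x S \<and> map \<pi> (en S) = en S'} = (if S = S' then {id} else {})"
    proof (cases "S = S'")
      case True
      have "\<pi> = id" if \<pi>: "\<pi> permutes insert x S" "map \<pi> (en S) = en S" for \<pi>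
      proof -
        have "\<pi> s = s" if "s \<in> S" for s
          using \<pi>(2) that en(2)[OF Kfin[OF \<open>S \<in> K\<close>]] by (metis map_eq_conv map_ident)
        then have "\<pi> permutes {x}" by (intro permutes_superset[OF \<pi>(1)]) auto
        then show ?thesis by simp
      qed
      then show ?thesis using True by auto
    next
      case False
      have "map \<pi> (en S) \<noteq> en S'" if \<pi>: "\<pi> permutes insert x S" for \<pi>
      proof
        assume "map \<pi> (en S) = en S'"
        then have "\<pi> ` S = S'" using en(2) Kfin that \<open>S \<in> K\<close> \<open>S' \<in> K\<close> by (metis list.set_map)
        then have "S' \<subseteq> insert x S" using permutes_in_image[OF \<pi>] by auto
        then have "S' \<subseteq> S" using \<open>S' \<in> K\<close> by (auto simp: K_def)
        moreover have "card S' = card S" using that \<open>S \<in> K\<close> \<open>S' \<in> K\<close> by (simp add: K_def)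
        ultimately show False using False Kfin[OF \<open>S \<in> K\<close>] card_subset_eq by metis
      qed
      then show ?thesis using False by auto
    qed
    then show ?thesis using bval[OF \<open>S \<in> K\<close>, of id S'] unfolding pt_def by simp
  qed
  have expand: "f = (\<Sum>S\<in>K. fscale (f (pt S)) (b S))" if "f \<in> W" for f
  proof -
    \<comment> \<open>The difference satisfies the relations and vanishes at every evaluation point,
      so \<open>hook_relations_eq_0\<close> applies to it.\<close>
    let ?g = "f - (\<Sum>S\<in>K. fscale (f (pt S)) (b S))"
    have "?g \<in> W"
      using sub that bW
      by (intro fun_space.subspace_diff fun_space.subspace_sum fun_space.subspace_scale) auto
    then have rel: "?g \<in> hook_relations I r" using W_rel by auto
    have van: "?g (pt S') = 0" if "S' \<in> K" for S'
    proof -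
      have "(\<Sum>S\<in>K. f (pt S) * b S (pt S')) = (\<Sum>S\<in>K. if S = S' then f (pt S) else 0)"
        using that dual by (intro sum.cong) auto
      then show ?thesis using that finK by (simp add: sum_fun_apply fscale_def)
    qed
    have "?g = 0"
    proof (rule hook_relations_eq_0[OF fin x rel])
      fix S assume "S \<subseteq> I - {x}" "card S = r"
      then have "S \<in> K" by (simp add: K_def)
      then show "distinct (en S) \<and> set (en S) = S" using en Kfin by blast
      from van[OF \<open>S \<in> K\<close>] show "?g (hook_tabloid I (en S)) = 0" by (simp only: pt_def)
    qed
    then show ?thesis by simp
  qed
  have hom: "module_hom fscale fscale (perm_act p)"
    by unfold_locales (auto simp: perm_act_def fscale_def fun_eq_iff algebra_simps)
  interpret hom: module_hom fscale fscale "perm_act p" by (rule hom)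
  have act: "map ((`) (inv p)) (hook_tabloid I xs) = hook_tabloid I (map (inv p) xs)" for xs
    by (rule image_hook_tabloid[OF permutes_inv[OF p]])
  have actW: "perm_act p f \<in> W" if "f \<in> W" for f
  proof -
    note perm_act_hook_polytabloid[OF fin p]
    moreover have "(p a, map p as) \<in> hook_columns I r" if "(a, as) \<in> hook_columns I r" for a as
      using that permutes_inj[OF p] permutes_in_image[OF p]
      by (auto simp: hook_columns_def distinct_map inj_on_def)
    ultimately have "perm_act p ` ((\<lambda>(a, as). hook_polytabloid I a as) ` hook_columns I r) \<subseteq> W"
      unfolding W by (force intro!: fun_space.span_base)
    moreover have "perm_act p f \<in> fun_space.span (perm_act p ` ((\<lambda>(a, as). hook_polytabloid I a as) ` hook_columns I r))"
      using that unfolding W by (auto simp: hom.span_image)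
    ultimately show ?thesis using fun_space.span_minimal[OF _ sub] by blast
  qed
  have "irr_char I ?l p = (\<Sum>S\<in>K. perm_act p (b S) (pt S))"
    unfolding irr_char_def W_def[symmetric]
    by (rule trace_on_frame[OF finK sub bW expand hom actW])
  also have "\<dots> = (\<Sum>S\<in>K. \<Sum>\<pi> | \<pi> permutes insert x S \<and> (\<forall>s\<in>S. \<pi> s = inv p s). of_int (sign \<pi>))"
  proof (rule sum.cong[OF refl])
    fix S assume S: "S \<in> K"
    have "perm_act p (b S) (pt S) = b S (hook_tabloid I (map (inv p) (en S)))"
      by (simp add: perm_act_def pt_def act)
    then show "perm_act p (b S) (pt S) = (\<Sum>\<pi> | \<pi> permutes insert x S \<and> (\<forall>s\<in>S. \<pi> s = inv p s). of_int (sign \<pi>))"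
      using bval[OF S] en(2)[OF Kfin[OF S]] by simp
  qed
  finally show ?thesis unfolding K_def .
qed

section \<open>The Murnaghan-Nakayama rule for hooks\<close>

text \<open>The orbit of any point of \<open>A\<close> stays inside \<open>A\<close>, and it is all
  of \<open>C\<close>.\<close>

lemma cyclic_on_invariant_subset:
  assumes "cyclic_on f C" "A \<subseteq> C" "A \<noteq> {}" "f ` A \<subseteq> A"
  shows "A = C"
proof -
  obtain a where a: "a \<in> A" using assms(3) by auto
  have "y \<in> A" if "y \<in> orbit f a" for y
    using that by induction (use a assms(4) in auto)
  moreover have "orbit f a = C" using orbit_cyclic_eq3[OF assms(1)] assms(2) a by blast
  ultimately show ?thesis using assms(2) by blast
qed

text \<open>The orbit of a point is a nonempty invariant set, so minimality makes it all of
  \<open>C\<close>. This form avoids computing orbits of modified permutations.\<close>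

lemma cyclic_onI_invariant:
  assumes "finite C" "f permutes C" "C \<noteq> {}"
    and inv: "\<And>A. A \<subseteq> C \<Longrightarrow> A \<noteq> {} \<Longrightarrow> f ` A \<subseteq> A \<Longrightarrow> A = C"
  shows "cyclic_on f C"
proof -
  obtain s where s: "s \<in> C" using assms(3) by auto
  have "orbit f s = C"
    by (rule inv) (auto simp: orbit_nonempty intro: orbit.step
        dest: permutes_orbit_subset[OF assms(2) s, THEN subsetD])
  then show ?thesis using s by (auto simp: cyclic_on_def)
qed

lemma cyclic_on_inv:
  assumes "finite C" "c permutes C" "cyclic_on c C"
  shows "cyclic_on (inv c) C"
  using assms orbit_inv_eq permutation_permutes unfolding cyclic_on_def by metis

text \<open>The quotient \<open>inv q \<circ> p\<close> can move at most the single point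
  \<open>x\<close>, so it is the identity.\<close>

lemma permutes_eqI:
  assumes "p permutes C" "q permutes C" "\<And>s. s \<in> C - {x} \<Longrightarrow> p s = q s"
  shows "p = q"
proof -
  have "inv q \<circ> p permutes C" using assms permutes_inv permutes_compose by blast
  then have "inv q \<circ> p permutes {x}"
    by (rule permutes_superset) (simp add: assms(3) permutes_inverses[OF assms(2)])
  then have "inv q (p s) = s" for s by (simp add: fun_eq_iff)
  then show ?thesis using permutes_inverses(1)[OF assms(2)] by (metis ext)
qed

text \<open>
  The pairs indexing the trace in \<open>irr_char_hook\<close>: subsets \<open>S\<close> on which \<open>q\<close> extends to a
  permutation of \<open>insert x S\<close>.
\<close>

definition hook_fillings :: "'a set \<Rightarrow> 'a \<Rightarrow> nat \<Rightarrow> ('a \<Rightarrow> 'a) \<Rightarrow> ('a set \<times> ('a \<Rightarrow> 'a)) set" where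
  "hook_fillings I x r q =
    {(S, \<pi>). S \<subseteq> I - {x} \<and> card S = r \<and> \<pi> permutes insert x S \<and> (\<forall>s\<in>S. \<pi> s = q s)}"

definition hook_trace :: "'a set \<Rightarrow> 'a \<Rightarrow> nat \<Rightarrow> ('a \<Rightarrow> 'a) \<Rightarrow> int" where
  "hook_trace I x r q = (\<Sum>(S, \<pi>)\<in>hook_fillings I x r q. sign \<pi>)"

section \<open>The character as a signed count of fillings\<close>

lemma finite_hook_fillings:
  assumes "finite I"
  shows "finite (hook_fillings I x r q)"
proof (rule finite_subset)
  show "hook_fillings I x r q \<subseteq> (SIGMA S:Pow (I - {x}). {\<pi>. \<pi> permutes insert x S})"
    by (auto simp: hook_fillings_def)
  show "finite (SIGMA S:Pow (I - {x}). {\<pi>. \<pi> permutes insert x S})"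
    using assms by (intro finite_SigmaI finite_permutations) (auto dest: finite_subset)
qed

lemma irr_char_hook_trace:
  assumes fin: "finite I" and "x \<in> I" "card I = j + r" "j \<ge> 1" "p permutes I"
  shows "irr_char I (j # replicate r 1) p = of_int (hook_trace I x r (inv p))"
proof -
  let ?K = "{S. S \<subseteq> I - {x} \<and> card S = r}"
  let ?P = "\<lambda>S. {\<pi>. \<pi> permutes insert x S \<and> (\<forall>s\<in>S. \<pi> s = inv p s)}"
  have eq: "hook_fillings I x r (inv p) = (SIGMA S:?K. ?P S)" by (auto simp: hook_fillings_def)
  have "finite ?K" using fin by simp
  moreover have "finite (?P S)" if "S \<in> ?K" for S
  proof (rule finite_subset)
    show "finite {\<pi>. \<pi> permutes insert x S}"
      using that fin by (intro finite_permutations) (auto dest: finite_subset)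
  qed auto
  ultimately have "(\<Sum>S\<in>?K. \<Sum>\<pi>\<in>?P S. sign \<pi>) = hook_trace I x r (inv p)"
    unfolding hook_trace_def eq by (intro sum.Sigma) auto
  then show ?thesis unfolding irr_char_hook[OF assms] by (simp flip: of_int_sum)
qed

text \<open>A set avoiding \<open>x\<close> has fewer than \<open>card I\<close> elements. This
  matches the vanishing of the hook character for \<open>j < 1\<close>, where the leg length is at
  least \<open>card I\<close>.\<close>

lemma hook_trace_eq_0:
  assumes "finite I" "x \<in> I" "r \<ge> card I"
  shows "hook_trace I x r q = 0"
proof -
  have "card S \<noteq> r" if "S \<subseteq> I - {x}" for S
  proof -
    have "card S < card I" using that assms(1,2) by (intro psubset_card_mono) auto
    then show ?thesis using assms(3) by simp
  qed
  then have "hook_fillings I x r q = {}" by (auto simp: hook_fillings_def)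
  then show ?thesis by (simp add: hook_trace_def)
qed

text \<open>Let \<open>y\<close> be the predecessor of \<open>x\<close> on the cycle. A nonempty
  admissible \<open>S\<close> contains \<open>y\<close>, since otherwise it would be invariant under
  \<open>q\<close>. Bypassing \<open>y\<close> gives a cycle on \<open>I - {y}\<close> and shortens
  \<open>S\<close> by one element; the transposition used contributes the factor -1.\<close>

lemma hook_trace_cyclic:
  assumes "finite I" "q permutes I" "cyclic_on q I" "x \<in> I" "r < card I"
  shows "hook_trace I x r q = (- 1) ^ r"
  using assms
proof (induction r arbitrary: I q)
  case 0
  have "hook_fillings I x 0 q = {({}, id)}"
  proof -
    have empty: "S \<subseteq> I - {x} \<and> card S = 0 \<longleftrightarrow> S = {}" for S
      using \<open>finite I\<close> by (metis card_eq_0_iff empty_subsetI finite_Diff finite_subset)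
    have "hook_fillings I x 0 q = {(S, \<pi>). (S \<subseteq> I - {x} \<and> card S = 0) \<and>
        \<pi> permutes insert x S \<and> (\<forall>s\<in>S. \<pi> s = q s)}"
      by (simp add: hook_fillings_def)
    also have "\<dots> = {({}, id)}" unfolding empty by auto
    finally show ?thesis .
  qed
  then show ?case by (simp add: hook_trace_def)
next
  case (Suc r)
  define y where "y = inv q x"
  have qy: "q y = x" unfolding y_def using Suc.prems(2) by (simp add: permutes_inverses)
  have yI: "y \<in> I" using permutes_in_image[OF Suc.prems(2), of y] qy Suc.prems(4) by simp
  have yx: "y \<noteq> x"
  proof
    assume "y = x"
    then have "{x} = I" using qy Suc.prems by (intro cyclic_on_invariant_subset[of q]) auto
    then show False using Suc.prems(5) by auto
  qed
  have inj: "inj q" using Suc.prems(2) by (rule permutes_inj)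
  have qs: "q s = x \<longleftrightarrow> s = y" for s using qy inj by (metis injD)
  let ?t = "transpose x y"
  \<comment> \<open>\<open>?q\<close> fixes \<open>y\<close> and sends the former predecessor of
    \<open>y\<close> straight to \<open>x\<close>.\<close>
  let ?q = "?t \<circ> q"
  have tt: "?t (?t s) = s" for s by simp
  have "?q permutes I"
    using Suc.prems(2,4) yI by (intro permutes_compose permutes_swap_id)
  then have perm: "?q permutes I - {y}"
    by (rule permutes_superset) (use qy yI in auto)
  have cyc: "cyclic_on ?q (I - {y})"
  proof (rule cyclic_onI_invariant[OF _ perm])
    show "finite (I - {y})" using Suc.prems(1) by simp
    show "I - {y} \<noteq> {}" using Suc.prems(4) yx by auto
    fix A assume A: "A \<subseteq> I - {y}" "A \<noteq> {}" "?q ` A \<subseteq> A"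
    \<comment> \<open>\<open>q\<close> can leave \<open>A\<close> only into \<open>y\<close>, and
      only if \<open>x \<in> A\<close>. Hence \<open>insert y A\<close> is invariant under
      \<open>q\<close> when \<open>x \<in> A\<close>, and \<open>A\<close> itself otherwise.\<close>
    have step: "q s \<in> insert y A" if "s \<in> A" for s
    proof -
      have "q s \<noteq> x" using that A qs by auto
      then show ?thesis using A(3) that by (cases "q s = y") (auto simp: image_subset_iff transpose_def)
    qed
    show "A = I - {y}"
    proof (cases "x \<in> A")
      case True
      have "insert y A = I"
        by (rule cyclic_on_invariant_subset[OF Suc.prems(3)]) (use A step yI qy True in auto)
      then show ?thesis using A by auto
    next
      case False
      have "q s \<noteq> y" if "s \<in> A" for s
        using A(3) that False by (auto simp: image_subset_iff)
      then have "A = I"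
        by (intro cyclic_on_invariant_subset[OF Suc.prems(3)]) (use A step in auto)
      then show ?thesis using False Suc.prems(4) by simp
    qed
  qed
  have IH: "hook_trace (I - {y}) x r ?q = (- 1) ^ r"
    by (rule Suc.IH[OF _ perm cyc]) (use Suc.prems(1,4,5) yx yI in auto)
  have "hook_trace I x (Suc r) q = (\<Sum>(S, \<pi>)\<in>hook_fillings (I - {y}) x r ?q. - sign \<pi>)"
    unfolding hook_trace_def
  proof (rule sum.reindex_bij_witness[where
        j = "\<lambda>(S, \<pi>). (S - {y}, ?t \<circ> \<pi>)" and i = "\<lambda>(S, \<pi>). (insert y S, ?t \<circ> \<pi>)"])
    fix a assume "a \<in> hook_fillings I x (Suc r) q"
    then obtain S \<pi> where a: "a = (S, \<pi>)" and S: "S \<subseteq> I - {x}" "card S = Suc r"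
      and \<pi>: "\<pi> permutes insert x S" "\<And>s. s \<in> S \<Longrightarrow> \<pi> s = q s"
      by (auto simp: hook_fillings_def)
    have finS: "finite S" using S(2) card.infinite by fastforce
    have yS: "y \<in> S"
    proof (rule ccontr)
      assume "y \<notin> S"
      have "q s \<in> S" if "s \<in> S" for s
      proof -
        have "q s \<in> insert x S" using \<pi> that permutes_in_image[OF \<pi>(1), of s] by auto
        moreover have "q s \<noteq> x" using \<open>y \<notin> S\<close> that qs by auto
        ultimately show ?thesis by simp
      qed
      then have "S = I"
        using S by (intro cyclic_on_invariant_subset[OF Suc.prems(3)]) auto
      then show False using S Suc.prems(4) by auto
    qed
    then show "(case (case a of (S, \<pi>) \<Rightarrow> (S - {y}, ?t \<circ> \<pi>)) of (S, \<pi>) \<Rightarrow> (insert y S, ?t \<circ> \<pi>)) = a"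
      by (auto simp: a fun_eq_iff)
    have "?t \<circ> \<pi> permutes insert x S"
      using \<pi>(1) yS by (intro permutes_compose permutes_swap_id) auto
    \<comment> \<open>Because \<open>\<pi> y = q y = x\<close>, following \<open>\<pi>\<close> by
      the swap turns \<open>y\<close> into a fixed point.\<close>
    then have "?t \<circ> \<pi> permutes insert x (S - {y})"
      by (rule permutes_superset) (use \<pi>(2)[OF yS] qy yx in auto)
    then show "(case a of (S, \<pi>) \<Rightarrow> (S - {y}, ?t \<circ> \<pi>)) \<in> hook_fillings (I - {y}) x r ?q"
      using S \<pi>(2) yS finS by (auto simp: a hook_fillings_def)
    have "permutation \<pi>" using \<pi>(1) finS permutation_permutes by blast
    then have "sign (?t \<circ> \<pi>) = - sign \<pi>"
      using yx by (simp add: sign_compose permutation_swap_id sign_swap_id)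
    then show "(case (case a of (S, \<pi>) \<Rightarrow> (S - {y}, ?t \<circ> \<pi>)) of (S, \<pi>) \<Rightarrow> - sign \<pi>) = (case a of (S, \<pi>) \<Rightarrow> sign \<pi>)"
      by (simp add: a)
  next
    fix a assume "a \<in> hook_fillings (I - {y}) x r ?q"
    then obtain S \<pi> where a: "a = (S, \<pi>)" and S: "S \<subseteq> I - {y} - {x}" "card S = r"
      and \<pi>: "\<pi> permutes insert x S" "\<And>s. s \<in> S \<Longrightarrow> \<pi> s = ?q s"
      by (auto simp: hook_fillings_def)
    have finS: "finite S" using S(1) Suc.prems(1) by (meson finite_Diff finite_subset)
    have yS: "y \<notin> S" using S by auto
    then show "(case (case a of (S, \<pi>) \<Rightarrow> (insert y S, ?t \<circ> \<pi>)) of (S, \<pi>) \<Rightarrow> (S - {y}, ?t \<circ> \<pi>)) = a"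
      by (auto simp: a fun_eq_iff)
    have "\<pi> permutes insert x (insert y S)" by (rule permutes_subset[OF \<pi>(1)]) auto
    then have "?t \<circ> \<pi> permutes insert x (insert y S)"
      by (intro permutes_compose permutes_swap_id) auto
    moreover have "\<pi> y = y" using permutes_not_in[OF \<pi>(1)] yS yx by auto
    ultimately show "(case a of (S, \<pi>) \<Rightarrow> (insert y S, ?t \<circ> \<pi>)) \<in> hook_fillings I x (Suc r) q"
      using S \<pi>(2) yS finS yI yx qy by (auto simp: a hook_fillings_def)
  qed
  also have "\<dots> = - hook_trace (I - {y}) x r ?q"
    unfolding hook_trace_def by (simp add: sum_negf case_prod_unfold)
  finally show ?case using IH by simp
qed

text \<open>For \<open>r = card C - 1\<close> the only filling is \<open>(C - {x}, c)\<close>, so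
  the trace found in \<open>hook_trace_cyclic\<close> is the sign of \<open>c\<close>.\<close>

lemma sign_cyclic:
  assumes "finite C" "c permutes C" "cyclic_on c C"
  shows "sign c = (- 1) ^ (card C - 1)"
proof -
  obtain x where x: "x \<in> C" using assms(3) by (auto simp: cyclic_on_def)
  have pos: "card C > 0" using x assms(1) card_gt_0_iff by blast
  have "hook_fillings C x (card C - 1) c = {(C - {x}, c)}"
  proof -
    have "S = C - {x}" if "S \<subseteq> C - {x}" "card S = card C - 1" for S
      using that assms(1) x by (intro card_subset_eq) auto
    moreover have "\<pi> = c" if "\<pi> permutes C" "\<forall>s\<in>C - {x}. \<pi> s = c s" for \<pi>
      using permutes_eqI[OF that(1) assms(2)] that(2) by blast
    moreover have "insert x (C - {x}) = C" using x by auto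
    ultimately show ?thesis
      using assms(1,2) x unfolding hook_fillings_def by (auto; metis)
  qed
  then show ?thesis
    using hook_trace_cyclic[OF assms x, of "card C - 1"] pos by (simp add: hook_trace_def)
qed

text \<open>As \<open>x\<close> lies outside \<open>C\<close>, the set \<open>S \<inter> C\<close>
  is invariant under \<open>c\<close>, hence empty or all of \<open>C\<close>. In the first case the
  filling already belongs to \<open>q\<close> on \<open>I - C\<close>; in the second, stripping
  \<open>c\<close> from \<open>\<pi>\<close> leaves a filling on \<open>S - C\<close> and costs the
  sign of \<open>c\<close>.\<close>

lemma hook_trace_remove_cycle:
  assumes fin: "finite I" and C: "C \<subseteq> I" and x: "x \<in> I - C"
    and c: "c permutes C" "cyclic_on c C" and q: "q permutes I - C"
    and g: "\<And>s. s \<in> C \<Longrightarrow> g s = c s" "\<And>s. s \<in> I - C \<Longrightarrow> g s = q s"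
  shows "hook_trace I x r g = hook_trace (I - C) x r q +
    (if card C \<le> r then (- 1) ^ (card C - 1) * hook_trace (I - C) x (r - card C) q else 0)"
proof -
  have finC: "finite C" using fin C finite_subset by blast
  have ne: "C \<noteq> {}" using c(2) by (auto simp: cyclic_on_def)
  let ?Z1 = "hook_fillings (I - C) x r q"
  define Z2 where "Z2 = {(S, \<pi>) \<in> hook_fillings I x r g. C \<subseteq> S}"
  have split: "hook_fillings I x r g = ?Z1 \<union> Z2"
  proof (intro equalityI subsetI)
    fix a assume a: "a \<in> hook_fillings I x r g"
    then obtain S \<pi> where a': "a = (S, \<pi>)" and S: "S \<subseteq> I - {x}" "card S = r"
      and \<pi>: "\<pi> permutes insert x S" "\<And>s. s \<in> S \<Longrightarrow> \<pi> s = g s"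
      by (auto simp: hook_fillings_def)
    have "c s \<in> S \<inter> C" if "s \<in> S \<inter> C" for s
    proof -
      have "c s \<in> C" using that permutes_in_image[OF c(1)] by auto
      moreover have "\<pi> s \<in> insert x S" using that permutes_in_image[OF \<pi>(1), of s] by auto
      ultimately show ?thesis using x \<pi>(2)[of s] g(1)[of s] that by auto
    qed
    then have "S \<inter> C = {} \<or> S \<inter> C = C"
      using cyclic_on_invariant_subset[OF c(2), of "S \<inter> C"] by auto
    then show "a \<in> ?Z1 \<union> Z2"
    proof
      assume "S \<inter> C = {}"
      then have "a \<in> ?Z1" using S \<pi> g(2) by (auto simp: a' hook_fillings_def subset_iff)
      then show ?thesis by simp
    next
      assume "S \<inter> C = C"
      then show ?thesis using a by (auto simp: Z2_def a')
    qed
  next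
    fix a assume "a \<in> ?Z1 \<union> Z2"
    then show "a \<in> hook_fillings I x r g"
      using g(2) by (auto simp: Z2_def hook_fillings_def subset_iff)
  qed
  have disj: "?Z1 \<inter> Z2 = {}" using ne by (auto simp: Z2_def hook_fillings_def)
  have fin12: "finite ?Z1" "finite Z2"
    using finite_hook_fillings[OF fin, of x r g] split by auto
  have Z2: "(\<Sum>(S, \<pi>)\<in>Z2. sign \<pi>) =
      (if card C \<le> r then (- 1) ^ (card C - 1) * hook_trace (I - C) x (r - card C) q else 0)"
  proof (cases "card C \<le> r")
    case True
    have "(\<Sum>(S, \<pi>)\<in>Z2. sign \<pi>) = (\<Sum>(S, \<pi>)\<in>hook_fillings (I - C) x (r - card C) q. sign c * sign \<pi>)"
    proof (rule sum.reindex_bij_witness[where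
          j = "\<lambda>(S, \<pi>). (S - C, inv c \<circ> \<pi>)" and i = "\<lambda>(S, \<pi>). (S \<union> C, c \<circ> \<pi>)"])
      note cc = permutes_inverses[OF c(1)]
      fix a assume "a \<in> Z2"
      then obtain S \<pi> where a: "a = (S, \<pi>)" and S: "S \<subseteq> I - {x}" "card S = r" "C \<subseteq> S"
        and \<pi>: "\<pi> permutes insert x S" "\<And>s. s \<in> S \<Longrightarrow> \<pi> s = g s"
        by (auto simp: hook_fillings_def Z2_def)
      have finS: "finite S" using S(1) fin by (meson finite_Diff finite_subset)
      show "(case (case a of (S, \<pi>) \<Rightarrow> (S - C, inv c \<circ> \<pi>)) of (S, \<pi>) \<Rightarrow> (S \<union> C, c \<circ> \<pi>)) = a"
        using S(3) by (auto simp: a fun_eq_iff cc)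
      have invc: "inv c permutes C" using c(1) by (rule permutes_inv)
      have "inv c \<circ> \<pi> permutes insert x S"
        using \<pi>(1) S(3) by (intro permutes_compose permutes_subset[OF invc]) auto
      then have "inv c \<circ> \<pi> permutes insert x (S - C)"
        by (rule permutes_superset) (use \<pi>(2) g(1) S(3) cc in auto)
      moreover have "inv c (\<pi> s) = q s" if "s \<in> S - C" for s
      proof -
        have sI: "s \<in> I - C" using S that by auto
        then have "q s \<notin> C" using permutes_in_image[OF q, of s] by auto
        then show ?thesis using that \<pi>(2) g(2)[OF sI] permutes_not_in[OF invc] by auto
      qed
      ultimately show "(case a of (S, \<pi>) \<Rightarrow> (S - C, inv c \<circ> \<pi>)) \<in> hook_fillings (I - C) x (r - card C) q"
        using S finS by (auto simp: a hook_fillings_def card_Diff_subset finC)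
      have "permutation \<pi>" "permutation (inv c)" "permutation c"
        using \<pi>(1) finS permutation_permutes invc finC c(1) by blast+
      then have "sign c * sign (inv c \<circ> \<pi>) = sign \<pi>"
        by (simp add: sign_compose sign_inverse)
      then show "(case (case a of (S, \<pi>) \<Rightarrow> (S - C, inv c \<circ> \<pi>)) of (S, \<pi>) \<Rightarrow> sign c * sign \<pi>) = (case a of (S, \<pi>) \<Rightarrow> sign \<pi>)"
        by (simp add: a)
    next
      note cc = permutes_inverses[OF c(1)]
      fix a assume "a \<in> hook_fillings (I - C) x (r - card C) q"
      then obtain S \<pi> where a: "a = (S, \<pi>)" and S: "S \<subseteq> I - C - {x}" "card S = r - card C"
        and \<pi>: "\<pi> permutes insert x S" "\<And>s. s \<in> S \<Longrightarrow> \<pi> s = q s"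
        by (auto simp: hook_fillings_def)
      have finS: "finite S" using S(1) fin by (meson finite_Diff finite_subset)
      have SC: "S \<inter> C = {}" using S by auto
      show "(case (case a of (S, \<pi>) \<Rightarrow> (S \<union> C, c \<circ> \<pi>)) of (S, \<pi>) \<Rightarrow> (S - C, inv c \<circ> \<pi>)) = a"
        using SC by (auto simp: a fun_eq_iff cc)
      have "c \<circ> \<pi> permutes insert x (S \<union> C)"
        by (intro permutes_compose permutes_subset[OF c(1)] permutes_subset[OF \<pi>(1)]) auto
      moreover have "c (\<pi> s) = g s" if "s \<in> S \<union> C" for s
      proof (cases "s \<in> C")
        case True
        then have "\<pi> s = s" using permutes_not_in[OF \<pi>(1), of s] SC x by auto
        then show ?thesis using True g(1) by simp
      next
        case False
        then have sI: "s \<in> I - C" "s \<in> S" using S that by auto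
        then have "q s \<notin> C" using permutes_in_image[OF q, of s] by auto
        then show ?thesis using sI \<pi>(2) g(2)[OF sI(1)] permutes_not_in[OF c(1)] by auto
      qed
      ultimately show "(case a of (S, \<pi>) \<Rightarrow> (S \<union> C, c \<circ> \<pi>)) \<in> Z2"
        using S SC finS finC C x True by (auto simp: a hook_fillings_def Z2_def card_Un_disjoint)
    qed
    then show ?thesis
      using True sign_cyclic[OF finC c]
      by (simp add: hook_trace_def sum_distrib_left case_prod_unfold)
  next
    case False
    have "card C \<le> card S" if "S \<subseteq> I - {x}" "C \<subseteq> S" for S
      using that fin by (intro card_mono) (auto dest: finite_subset)
    then have "Z2 = {}" using False by (auto simp: Z2_def hook_fillings_def)
    then show ?thesis using False by simp
  qed
  have "hook_trace I x r g = (\<Sum>(S, \<pi>)\<in>?Z1. sign \<pi>) + (\<Sum>(S, \<pi>)\<in>Z2. sign \<pi>)"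
    unfolding hook_trace_def split by (rule sum.union_disjoint[OF fin12 disj])
  then show ?thesis unfolding Z2 by (simp add: hook_trace_def)
qed

text \<open>The case \<open>I = {}\<close> repeats the convention of \<open>hook_immanant\<close>.\<close>

definition hook_char :: "int \<Rightarrow> 'a set \<Rightarrow> ('a \<Rightarrow> 'a) \<Rightarrow> real" where
  "hook_char j I p =
    (if j < 1 then 0
     else if I = {} then (-1) ^ (nat j - 1)
     else if j > int (card I) then 0
     else irr_char I (nat j # replicate (card I - nat j) 1) p)"

section \<open>The rule for characters, with degenerate hooks included\<close>

lemma hook_char_eq_trace:
  assumes "finite I" "x \<in> I" "p permutes I" "j \<le> int (card I)"
  shows "hook_char j I p = of_int (hook_trace I x (nat (int (card I) - j)) (inv p))"
proof (cases "j < 1")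
  case True
  \<comment> \<open>Both sides are 0 here. The opposite range \<open>j > card I\<close> is excluded
    by hypothesis: \<open>nat\<close> would truncate the leg length to 0, where the trace is
    1.\<close>
  then have "card I \<le> nat (int (card I) - j)" by simp
  then show ?thesis using True hook_trace_eq_0[OF assms(1,2)] by (simp add: hook_char_def)
next
  case False
  have "hook_char j I p = irr_char I (nat j # replicate (card I - nat j) 1) p"
    using False assms by (auto simp: hook_char_def)
  also have "\<dots> = of_int (hook_trace I x (card I - nat j) (inv p))"
    using False assms by (intro irr_char_hook_trace) auto
  also have "card I - nat j = nat (int (card I) - j)" using False assms(4) by linarith
  finally show ?thesis .
qed

text \<open>If some \<open>x\<close> lies outside \<open>C\<close>, this is
  \<open>hook_trace_remove_cycle\<close> for the inverse permutations: shortening the arm keeps the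
  leg length \<open>r\<close>, while keeping the arm lowers it by \<open>card C\<close>. If
  \<open>I = C\<close> there is no such point, and the value at a full cycle is compared with the
  convention for the empty index set.\<close>

theorem hook_char_remove_cycle:
  assumes fin: "finite I" and C: "C \<subseteq> I" and c: "c permutes C" "cyclic_on c C"
    and q: "q permutes I - C"
  shows "hook_char j I (c \<circ> q) =
    hook_char (j - int (card C)) (I - C) q - (- 1) ^ card C * hook_char j (I - C) q"
proof -
  have finC: "finite C" using fin C finite_subset by blast
  have ne: "C \<noteq> {}" using c(2) by (auto simp: cyclic_on_def)
  have pos: "card C \<ge> 1" using ne finC by (simp add: Suc_leI card_gt_0_iff)
  have card: "card (I - C) = card I - card C" "card C \<le> card I"
    using card_Diff_subset[OF finC C] card_mono[OF fin C] by auto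
  have invc: "inv c permutes C" "cyclic_on (inv c) C"
    using permutes_inv[OF c(1)] cyclic_on_inv[OF finC c] by auto
  have invq: "inv q permutes I - C" using permutes_inv[OF q] .
  have perm: "c \<circ> q permutes I"
    using C by (intro permutes_compose permutes_subset[OF q] permutes_subset[OF c(1)]) auto
  have inv_eq: "inv (c \<circ> q) = inv q \<circ> inv c"
    using permutes_bij[OF c(1)] permutes_bij[OF q] by (simp add: o_inv_distrib)
  have gC: "inv (c \<circ> q) s = inv c s" if "s \<in> C" for s
    using that permutes_in_image[OF invc(1), of s] permutes_not_in[OF invq] by (auto simp: inv_eq)
  have gI: "inv (c \<circ> q) s = inv q s" if "s \<in> I - C" for s
    using that permutes_not_in[OF invc(1)] by (auto simp: inv_eq)
  show ?thesis
  proof (cases "I = C")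
    case True
    then have "q = id" using q by simp
    obtain x where x: "x \<in> C" using ne by auto
    \<comment> \<open>In the first range every term is 0. In the second only the term with
      \<open>hook_char j\<close> on the empty set survives on the right. In the third the left side
      is 0 and the two values on the empty set cancel.\<close>
    consider "j < 1" | "1 \<le> j" "j \<le> int (card C)" | "j > int (card C)" by linarith
    then show ?thesis
    proof cases
      case 1
      then show ?thesis using pos by (simp add: hook_char_def)
    next
      case 2
      then obtain m where m: "j = int m" "1 \<le> m" "m \<le> card C"
        by (metis nat_0_le nat_le_iff of_nat_1 of_nat_le_iff order_trans zero_le_one)
      have "hook_char j I (c \<circ> q) = of_int (hook_trace C x (card C - m) (inv c))"
        using hook_char_eq_trace[OF finC x c(1), of j] True \<open>q = id\<close> m by (simp add: nat_diff_distrib')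
      also have "\<dots> = (- 1) ^ (card C - m)"
        using hook_trace_cyclic[OF finC invc x, of "card C - m"] m pos by simp
      also have "\<dots> = - ((- 1) ^ card C * (- 1) ^ (m - 1))"
      proof -
        obtain d where d: "card C = m + d" using m(3) le_Suc_ex by blast
        obtain e where e: "m = Suc e" using m(2) by (cases m) auto
        show ?thesis unfolding d e by (simp add: power_add mult.assoc mult.left_commute flip: power_mult_distrib)
      qed
      finally show ?thesis using True m by (simp add: hook_char_def)
    next
      case 3
      define d where "d = nat (j - int (card C)) - 1"
      have d: "nat (j - int (card C)) - 1 = d" "nat j - 1 = card C + d"
        using 3 by (auto simp: d_def)
      have "(- 1) ^ card C * (- 1) ^ (card C + d) = ((- 1) ^ d :: real)"
        by (simp add: power_add flip: mult.assoc power_mult_distrib)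
      then show ?thesis using True 3 ne pos d by (simp add: hook_char_def)
    qed
  next
    case False
    then obtain x where x: "x \<in> I - C" using C by auto
    have n': "card (I - C) \<ge> 1" using x fin by (metis One_nat_def Suc_leI card_gt_0_iff empty_iff finite_Diff)
    show ?thesis
    proof (cases "j \<le> int (card I)")
      case True
      define r where "r = nat (int (card I) - j)"
      have A: "hook_char j I (c \<circ> q) = of_int (hook_trace I x r (inv (c \<circ> q)))"
        unfolding r_def using x by (intro hook_char_eq_trace[OF fin _ perm True]) auto
      have B: "hook_char (j - int (card C)) (I - C) q = of_int (hook_trace (I - C) x r (inv q))"
      proof -
        have "nat (int (card (I - C)) - (j - int (card C))) = r"
          unfolding r_def card(1) using card(2) by (simp add: of_nat_diff)
        then show ?thesis
          using hook_char_eq_trace[of "I - C" x q "j - int (card C)"] fin x q card True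
          by (simp add: of_nat_diff)
      qed
      have D: "hook_char j (I - C) q =
          (if card C \<le> r then of_int (hook_trace (I - C) x (r - card C) (inv q)) else 0)"
      proof (cases "card C \<le> r")
        case True
        then have "j \<le> int (card (I - C))" using pos by (simp add: r_def card of_nat_diff)
        moreover have "nat (int (card (I - C)) - j) = r - card C"
          unfolding r_def card(1) using card(2) by (simp add: of_nat_diff)
        ultimately show ?thesis
          using True hook_char_eq_trace[of "I - C" x q j] fin x q by simp
      next
        case False
        \<comment> \<open>A leg shorter than \<open>card C\<close> means that an arm of length
          \<open>j\<close> no longer fits into \<open>I - C\<close>.\<close>
        then have "j > int (card (I - C))" using True card by (simp add: r_def of_nat_diff)
        then show ?thesis using False x by (auto simp: hook_char_def)
      qed
      have "hook_trace I x r (inv (c \<circ> q)) = hook_trace (I - C) x r (inv q) +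
        (if card C \<le> r then (- 1) ^ (card C - 1) * hook_trace (I - C) x (r - card C) (inv q) else 0)"
        by (rule hook_trace_remove_cycle[OF fin C x invc invq gC gI])
      moreover have "(- 1) ^ (card C - 1) = (- ((- 1) ^ card C) :: real)"
        using pos by (cases "card C") auto
      ultimately show ?thesis unfolding A B D by simp
    next
      case False
      then show ?thesis using x C pos card n' by (auto simp: hook_char_def of_nat_diff)
    qed
  qed
qed

section \<open>Expanding immanants along a cycle\<close>

lemma hook_immanant_eq_hook_char:
  "hook_immanant j I M = (\<Sum>p | p permutes I. hook_char j I p * (\<Prod>i\<in>I. M i (p i)))"
  by (simp add: hook_immanant_def hook_char_def)

lemma hook_immanant_cong:
  assumes "\<And>i j. i \<in> I \<Longrightarrow> j \<in> I \<Longrightarrow> M i j = M' i j"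
  shows "hook_immanant k I M = hook_immanant k I M'"
  unfolding hook_immanant_eq_hook_char
  by (intro sum.cong refl arg_cong2[where f = "(*)"] prod.cong assms) (auto simp: permutes_in_image)

text \<open>The support is recorded along with the permutation so that the trivial cycle at
  \<open>v\<close>, the pair \<open>({v}, id)\<close>, is included.\<close>

definition rooted_cycles :: "'a set \<Rightarrow> 'a \<Rightarrow> ('a set \<times> ('a \<Rightarrow> 'a)) set" where
  "rooted_cycles I v = {(C, c). v \<in> C \<and> C \<subseteq> I \<and> c permutes C \<and> cyclic_on c C}"

lemma finite_rooted_cycles:
  assumes "finite I"
  shows "finite (rooted_cycles I v)"
proof (rule finite_subset)
  show "rooted_cycles I v \<subseteq> (SIGMA C:Pow I. {c. c permutes C})"
    by (auto simp: rooted_cycles_def)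
  show "finite (SIGMA C:Pow I. {c. c permutes C})"
    using assms by (intro finite_SigmaI finite_permutations) (auto dest: finite_subset)
qed

text \<open>The inverse map restricts \<open>p\<close> to the orbit of \<open>v\<close> and to its
  complement. For injectivity, two cycles coming from the same permutation agree on the intersection
  of their supports, which is therefore invariant and equal to both.\<close>

lemma bij_betw_rooted_cycles:
  assumes fin: "finite I" and v: "v \<in> I"
  shows "bij_betw (\<lambda>(a, q). snd a \<circ> q)
    (SIGMA a:rooted_cycles I v. {q. q permutes I - fst a}) {p. p permutes I}"
  unfolding bij_betw_def
proof (intro conjI equalityI subsetI)
  have act: "(c \<circ> q) s = c s" if "s \<in> C" "q permutes I - C" for c q s C
    using that by (simp add: permutes_not_in)
  have sub: "C \<subseteq> C'"
    if "v \<in> C" "cyclic_on c C" "q permutes I - C" "v \<in> C'" "c' permutes C'" "q' permutes I - C'"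
      and eq: "c \<circ> q = c' \<circ> q'" for C c q C' c' q'
  proof -
    have "c s \<in> C \<inter> C'" if s: "s \<in> C \<inter> C'" for s
    proof -
      have "c s = c' s" using act[of s C q c] act[of s C' q' c'] s eq \<open>q permutes I - C\<close> \<open>q' permutes I - C'\<close> by simp
      then show ?thesis using s permutes_in_image[OF \<open>c' permutes C'\<close>, of s] cyclic_on_inI[OF \<open>cyclic_on c C\<close>, of s] by auto
    qed
    then have "C \<inter> C' = C" using that by (intro cyclic_on_invariant_subset[OF \<open>cyclic_on c C\<close>]) auto
    then show ?thesis by auto
  qed
  show "inj_on (\<lambda>(a, q). snd a \<circ> q) (SIGMA a:rooted_cycles I v. {q. q permutes I - fst a})"
  proof (rule inj_onI, clarsimp)
    fix C c q C' c' q'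
    assume r: "(C, c) \<in> rooted_cycles I v" "(C', c') \<in> rooted_cycles I v"
      and q: "q permutes I - C" "q' permutes I - C'" and eq: "c \<circ> q = c' \<circ> q'"
    have c: "v \<in> C" "c permutes C" "cyclic_on c C" "v \<in> C'" "c' permutes C'" "cyclic_on c' C'"
      using r by (auto simp: rooted_cycles_def)
    have CC: "C = C'"
      using sub[OF c(1,3) q(1) c(4,5) q(2) eq] sub[OF c(4,6) q(2) c(1,2) q(1) eq[symmetric]] by auto
    have "c s = c' s" for s
      using act[of s C q c] act[of s C q' c'] q eq permutes_not_in[OF c(2)] permutes_not_in[OF c(5)] CC
      by (cases "s \<in> C") auto
    then have "c = c'" by auto
    then have "q = q'" using eq permutes_inj[OF c(2)] by (metis fun.inj_map_strong injD)
    with CC \<open>c = c'\<close> show "C = C' \<and> c = c' \<and> q = q'" by simp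
  qed
next
  fix p assume "p \<in> (\<lambda>(a, q). snd a \<circ> q) ` (SIGMA a:rooted_cycles I v. {q. q permutes I - fst a})"
  then obtain C c q where c: "C \<subseteq> I" "c permutes C" "q permutes I - C" "p = c \<circ> q"
    by (auto simp: rooted_cycles_def)
  then show "p \<in> {p. p permutes I}"
    by (auto intro!: permutes_compose intro: permutes_subset)
next
  fix p assume "p \<in> {p. p permutes I}"
  then have p: "p permutes I" by simp
  define C where "C = orbit p v"
  have cyc: "cyclic_on p C" unfolding C_def by (rule cyclic_on_orbit[OF p fin])
  have CI: "C \<subseteq> I" unfolding C_def by (rule permutes_orbit_subset[OF p v])
  have vC: "v \<in> C" unfolding C_def using p fin permutation_permutes by (blast intro: permutation_self_in_orbit)
  have inj: "inj p" using p by (rule permutes_inj)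
  have im: "p ` C = C"
    using cyc inj CI fin by (intro endo_inj_surj) (auto simp: cyclic_on_inI inj_on_def inj_def dest: finite_subset)
  have im': "p ` (I - C) = I - C" using image_set_diff[OF inj] permutes_image[OF p] im by simp
  have c: "restrict_id p C permutes C"
    using im inj by (intro permutes_restrict_id) (auto simp: bij_betw_def inj_on_def inj_def)
  have q: "restrict_id p (I - C) permutes I - C"
    using im' inj by (intro permutes_restrict_id) (auto simp: bij_betw_def inj_on_def inj_def)
  have "cyclic_on (restrict_id p C) C"
    using cyc by (subst cyclic_cong[where g = p]) auto
  then have "(C, restrict_id p C) \<in> rooted_cycles I v" using c vC CI by (simp add: rooted_cycles_def)
  moreover have "p = restrict_id p C \<circ> restrict_id p (I - C)"
  proof
    fix s
    show "p s = (restrict_id p C \<circ> restrict_id p (I - C)) s"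
      using im' permutes_not_in[OF p] CI by (cases "s \<in> I"; cases "s \<in> C") (auto simp: restrict_id_def)
  qed
  ultimately show "p \<in> (\<lambda>(a, q). snd a \<circ> q) ` (SIGMA a:rooted_cycles I v. {q. q permutes I - fst a})"
    using q by (intro image_eqI[of _ _ "((C, restrict_id p C), restrict_id p (I - C))"]) auto
qed

text \<open>The two terms of the Murnaghan-Nakayama rule, summed over the permutations of
  \<open>I - C\<close>; this is the factor multiplying the weight of each cycle on
  \<open>C\<close>.\<close>

definition cycle_cofactor :: "int \<Rightarrow> 'a set \<Rightarrow> ('a \<Rightarrow> 'a \<Rightarrow> real) \<Rightarrow> 'a set \<Rightarrow> real" where
  "cycle_cofactor k I M C =
    hook_immanant (k - int (card C)) (I - C) M - (- 1) ^ card C * hook_immanant k (I - C) M"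

text \<open>For \<open>p = c \<circ> q\<close> the product of entries splits over \<open>C\<close>
  and \<open>I - C\<close>, and the character splits by \<open>hook_char_remove_cycle\<close>.
  Summing over \<open>q\<close> with the cycle fixed yields the cofactor.\<close>

theorem hook_immanant_expand:
  assumes fin: "finite I" and v: "v \<in> I"
  shows "hook_immanant k I M =
    (\<Sum>(C, c)\<in>rooted_cycles I v. (\<Prod>i\<in>C. M i (c i)) * cycle_cofactor k I M C)"
proof -
  let ?R = "rooted_cycles I v"
  have "hook_immanant k I M = (\<Sum>(a, q)\<in>(SIGMA a:?R. {q. q permutes I - fst a}).
      hook_char k I (snd a \<circ> q) * (\<Prod>i\<in>I. M i ((snd a \<circ> q) i)))"
    unfolding hook_immanant_eq_hook_char
    by (subst sum.reindex_bij_betw[OF bij_betw_rooted_cycles[OF fin v], symmetric])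
      (simp add: case_prod_unfold)
  also have "\<dots> = (\<Sum>a\<in>?R. \<Sum>q | q permutes I - fst a.
      hook_char k I (snd a \<circ> q) * (\<Prod>i\<in>I. M i ((snd a \<circ> q) i)))"
    using fin by (intro sum.Sigma[symmetric] finite_rooted_cycles) (auto intro: finite_permutations)
  also have "\<dots> = (\<Sum>a\<in>?R. (\<Prod>i\<in>fst a. M i (snd a i)) * cycle_cofactor k I M (fst a))"
  proof (rule sum.cong[OF refl])
    fix a assume "a \<in> ?R"
    then obtain C c where a: "a = (C, c)" and C: "C \<subseteq> I" "c permutes C" "cyclic_on c C"
      by (auto simp: rooted_cycles_def)
    let ?w = "\<Prod>i\<in>C. M i (c i)"
    have "(\<Sum>q | q permutes I - C. hook_char k I (c \<circ> q) * (\<Prod>i\<in>I. M i ((c \<circ> q) i))) =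
       (\<Sum>q | q permutes I - C. ?w *
          (hook_char (k - int (card C)) (I - C) q * (\<Prod>i\<in>I - C. M i (q i))
           - (- 1) ^ card C * (hook_char k (I - C) q * (\<Prod>i\<in>I - C. M i (q i)))))"
    proof (rule sum.cong[OF refl])
      fix q assume "q \<in> {q. q permutes I - C}"
      then have q: "q permutes I - C" by simp
      have "(\<Prod>i\<in>I. M i ((c \<circ> q) i)) = (\<Prod>i\<in>I - C. M i ((c \<circ> q) i)) * (\<Prod>i\<in>C. M i ((c \<circ> q) i))"
        by (rule prod.subset_diff[OF C(1) fin])
      also have "(\<Prod>i\<in>C. M i ((c \<circ> q) i)) = ?w"
        using permutes_not_in[OF q] by (intro prod.cong) auto
      also have "(\<Prod>i\<in>I - C. M i ((c \<circ> q) i)) = (\<Prod>i\<in>I - C. M i (q i))"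
      proof (rule prod.cong[OF refl])
        fix i assume "i \<in> I - C"
        then have "q i \<notin> C" using permutes_in_image[OF q, of i] by auto
        then show "M i ((c \<circ> q) i) = M i (q i)" using permutes_not_in[OF C(2)] by simp
      qed
      finally show "hook_char k I (c \<circ> q) * (\<Prod>i\<in>I. M i ((c \<circ> q) i)) = ?w *
          (hook_char (k - int (card C)) (I - C) q * (\<Prod>i\<in>I - C. M i (q i))
           - (- 1) ^ card C * (hook_char k (I - C) q * (\<Prod>i\<in>I - C. M i (q i))))"
        unfolding hook_char_remove_cycle[OF fin C q] by (simp add: algebra_simps)
    qed
    also have "\<dots> = ?w * cycle_cofactor k I M C"
      unfolding cycle_cofactor_def hook_immanant_eq_hook_char
      by (simp only: sum_distrib_left[symmetric] sum_subtractf)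
    finally show "(\<Sum>q | q permutes I - fst a. hook_char k I (snd a \<circ> q) * (\<Prod>i\<in>I. M i ((snd a \<circ> q) i)))
       = (\<Prod>i\<in>fst a. M i (snd a i)) * cycle_cofactor k I M (fst a)" by (simp add: a)
  qed
  finally show ?thesis by (simp add: case_prod_unfold)
qed

section \<open>Trivial cycles and the dependence on diagonal entries\<close>

lemma cycle_cofactor_cong:
  assumes "\<And>i j. i \<in> I - C \<Longrightarrow> j \<in> I - C \<Longrightarrow> M i j = M' i j"
  shows "cycle_cofactor k I M C = cycle_cofactor k I M' C"
  unfolding cycle_cofactor_def using hook_immanant_cong[of "I - C" M M'] assms by simp

lemma cycle_cofactor_singleton:
  "cycle_cofactor k I M {x} = hook_immanant (k - 1) (I - {x}) M + hook_immanant k (I - {x}) M"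
  by (simp add: cycle_cofactor_def)

lemma singleton_in_rooted_cycles: "v \<in> I \<Longrightarrow> ({v}, id) \<in> rooted_cycles I v"
  using orbit_eq_singleton_iff[of id v] by (auto simp: rooted_cycles_def cyclic_on_def)

lemma rooted_cycle_card_1:
  assumes "(C, c) \<in> rooted_cycles I v" "card C = 1"
  shows "(C, c) = ({v}, id)"
proof -
  have "C = {v}" using assms by (auto simp: rooted_cycles_def card_1_singleton_iff)
  then show ?thesis using assms by (simp add: rooted_cycles_def)
qed

lemma rooted_cycle_no_fixpoint:
  assumes "(C, c) \<in> rooted_cycles I v" "(C, c) \<noteq> ({v}, id)" "i \<in> C"
  shows "c i \<noteq> i"
proof -
  have "cyclic_on c C" using assms(1) by (simp add: rooted_cycles_def)
  then have "c i = i \<longleftrightarrow> card C = 1" using assms(3) by (rule eq_on_cyclic_on_iff1)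
  then show ?thesis using rooted_cycle_card_1[OF assms(1)] assms(2) by blast
qed

text \<open>In the expansion along \<open>x\<close>, only the trivial cycle uses the entry
  \<open>M x x\<close>: the other cycles have no fixed point, and every cofactor lives away from
  \<open>x\<close>. The immanant is thus affine in that entry, with slope the cofactor of
  \<open>{x}\<close>.\<close>

lemma hook_immanant_change_diagonal:
  assumes fin: "finite I" and x: "x \<in> I"
    and eq: "\<And>i j. i \<in> I \<Longrightarrow> j \<in> I \<Longrightarrow> (i, j) \<noteq> (x, x) \<Longrightarrow> M i j = M' i j"
  shows "hook_immanant k I M = hook_immanant k I M' + (M x x - M' x x) *
    (hook_immanant (k - 1) (I - {x}) M' + hook_immanant k (I - {x}) M')"
proof -
  let ?R = "rooted_cycles I x"
  let ?t = "\<lambda>M. \<lambda>(C, c). (\<Prod>i\<in>C. M i (c i)) * cycle_cofactor k I M C"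
  have split: "hook_immanant k I M = M x x * cycle_cofactor k I M {x} + sum (?t M) (?R - {({x}, id)})" for M
    unfolding hook_immanant_expand[OF fin x]
    by (subst sum.remove[OF finite_rooted_cycles[OF fin] singleton_in_rooted_cycles[OF x]]) simp
  have cof: "cycle_cofactor k I M C = cycle_cofactor k I M' C" if "x \<in> C" for C
    using that by (intro cycle_cofactor_cong eq) auto
  have "sum (?t M) (?R - {({x}, id)}) = sum (?t M') (?R - {({x}, id)})"
  proof (rule sum.cong[OF refl])
    fix a assume "a \<in> ?R - {({x}, id)}"
    then obtain C c where a: "a = (C, c)" "(C, c) \<in> ?R" "(C, c) \<noteq> ({x}, id)"
      by (cases a) auto
    then have C: "x \<in> C" "C \<subseteq> I" "c permutes C" by (auto simp: rooted_cycles_def)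
    have "(\<Prod>i\<in>C. M i (c i)) = (\<Prod>i\<in>C. M' i (c i))"
    proof (rule prod.cong[OF refl])
      fix i assume i: "i \<in> C"
      then have "c i \<in> C" using permutes_in_image[OF C(3)] by simp
      then show "M i (c i) = M' i (c i)"
        using eq[of i "c i"] i C(2) rooted_cycle_no_fixpoint[OF a(2,3) i] by auto
    qed
    then show "?t M a = ?t M' a" using cof[OF C(1)] by (simp add: a(1))
  qed
  moreover have "cycle_cofactor k I M {x} = cycle_cofactor k I M' {x}" by (rule cof) simp
  ultimately show ?thesis
    unfolding split[of M] split[of M'] cycle_cofactor_singleton[of k I M', symmetric]
    by (simp add: left_diff_distrib)
qed

section \<open>Cyclic permutations and cycles of graphs\<close>

definition cycle_edges :: "'a set \<Rightarrow> ('a \<Rightarrow> 'a) \<Rightarrow> 'a set set" where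
  "cycle_edges C c = (\<lambda>i. {i, c i}) ` C"

lemma Union_cycle_edges: "c permutes C \<Longrightarrow> \<Union>(cycle_edges C c) = C"
  by (auto simp: cycle_edges_def permutes_in_image)

text \<open>An orientation of the cycle is the permutation moving each listed vertex to the next,
  which takes \<open>vs\<close> to \<open>rotate1 vs\<close>.\<close>

lemma is_cycle_obtain:
  assumes "is_cycle X"
  obtains C c where "card C \<ge> 3" "c permutes C" "cyclic_on c C" "X = cycle_edges C c"
proof -
  obtain vs where vs: "length vs \<ge> 3" "distinct vs"
      "X = {{vs ! i, vs ! (Suc i mod length vs)} | i. i < length vs}"
    using assms by (auto simp: is_cycle_def)
  let ?n = "length vs"
  obtain c where c: "c permutes set vs" "map c vs = rotate1 vs"
    using obtain_permutes_map_eq[of vs "rotate1 vs"] vs(2) by auto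
  have cnth: "c (vs ! i) = vs ! (Suc i mod ?n)" if "i < ?n" for i
    using arg_cong[OF c(2), of "\<lambda>l. l ! i"] that by (simp add: nth_rotate1)
  have "cyclic_on c (set vs)"
  proof (rule cyclic_onI_invariant[OF _ c(1)])
    show "set vs \<noteq> {}" using vs(1) by auto
    fix A assume A: "A \<subseteq> set vs" "A \<noteq> {}" "c ` A \<subseteq> A"
    then obtain i where i: "i < ?n" "vs ! i \<in> A" by (metis ex_in_conv in_set_conv_nth subsetD)
    have reach: "vs ! ((i + k) mod ?n) \<in> A" for k
    proof (induction k)
      case 0
      then show ?case using i by simp
    next
      case (Suc k)
      have "(i + k) mod ?n < ?n" using i(1) by (intro mod_less_divisor) auto
      then have "c (vs ! ((i + k) mod ?n)) = vs ! ((i + Suc k) mod ?n)"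
        using cnth by (simp add: mod_Suc_eq)
      then show ?case using Suc A(3) by (metis image_subset_iff)
    qed
    have "vs ! j \<in> A" if "j < ?n" for j
    proof -
      \<comment> \<open>The number of steps \<open>?n - i + j\<close> stands in for
        \<open>j - i\<close>, which may be negative.\<close>
      have "i + (?n - i + j) = ?n + j" using i(1) by simp
      then have "(i + (?n - i + j)) mod ?n = j" using that by simp
      then show ?thesis using reach[of "?n - i + j"] by simp
    qed
    then show "A = set vs" using A(1) by (auto simp: in_set_conv_nth)
  qed simp
  moreover have "X = cycle_edges (set vs) c"
    unfolding vs(3) cycle_edges_def set_conv_nth using cnth by auto
  moreover have "card (set vs) \<ge> 3" using vs distinct_card by metis
  ultimately show ?thesis using that c(1) by blast
qed

text \<open>The vertex list consists of the iterates of \<open>c\<close> at \<open>v\<close> up to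
  the first return time \<open>n\<close>. Minimality of \<open>n\<close> makes the list distinct,
  and the return supplies the closing edge.\<close>

lemma is_cycle_cycle_edges:
  assumes "card C \<ge> 3" "c permutes C" "cyclic_on c C"
  shows "is_cycle (cycle_edges C c)"
proof -
  have fin: "finite C" using assms(3) by (rule finite_cyclic_on)
  obtain v where v: "v \<in> C" using assms(3) by (auto simp: cyclic_on_def)
  have orb: "orbit c v = C" using orbit_cyclic_eq3[OF assms(3) v] .
  have "v \<in> orbit c v" using orb v by simp
  then have ex: "\<exists>m>0. (c ^^ m) v = v" by (auto simp: orbit_altdef)
  define n where "n = (LEAST m. m > 0 \<and> (c ^^ m) v = v)"
  have n: "n > 0" "(c ^^ n) v = v" unfolding n_def using LeastI_ex[OF ex] by auto
  have least: "(c ^^ m) v \<noteq> v" if "0 < m" "m < n" for m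
    using not_less_Least[of m "\<lambda>m. m > 0 \<and> (c ^^ m) v = v"] that unfolding n_def by blast
  have inj: "inj_on (\<lambda>k. (c ^^ k) v) {0..<n}" by (rule inj_on_funpow_least[OF n(2) least])
  have C: "C = (\<lambda>k. (c ^^ k) v) ` {0..<n}"
    using orbit_altdef_bounded[OF n(2,1)] orb by auto
  then have card: "card C = n" using card_image[OF inj] by simp
  define vs where "vs = map (\<lambda>k. (c ^^ k) v) [0..<n]"
  have "length vs \<ge> 3" "distinct vs"
    using assms(1) card inj by (auto simp: vs_def distinct_map)
  moreover have "cycle_edges C c = {{vs ! i, vs ! (Suc i mod length vs)} | i. i < length vs}"
  proof -
    have step: "vs ! (Suc i mod length vs) = c ((c ^^ i) v)" if "i < n" for i
    proof (cases "Suc i < n")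
      case True
      then show ?thesis by (simp add: vs_def)
    next
      case False
      then have "Suc i = n" using that by simp
      then show ?thesis using n by (auto simp: vs_def)
    qed
    have "cycle_edges C c = (\<lambda>i. {(c ^^ i) v, c ((c ^^ i) v)}) ` {0..<n}"
      unfolding cycle_edges_def C by (simp add: image_image)
    also have "\<dots> = (\<lambda>i. {vs ! i, vs ! (Suc i mod length vs)}) ` {0..<n}"
      using step by (intro image_cong) (auto simp: vs_def)
    also have "\<dots> = {{vs ! i, vs ! (Suc i mod length vs)} | i. i < length vs}"
    proof -
      have "n = length vs" by (simp add: vs_def)
      then show ?thesis by auto
    qed
    finally show ?thesis .
  qed
  ultimately show ?thesis unfolding is_cycle_def by blast
qed

text \<open>Otherwise \<open>{i, c i}\<close> would be invariant and hence equal to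
  \<open>C\<close>, which is too large.\<close>

lemma cyclic_on_not_involutive:
  assumes "cyclic_on c C" "card C \<ge> 3" "i \<in> C"
  shows "c (c i) \<noteq> i"
proof
  assume "c (c i) = i"
  then have "{i, c i} = C"
    using assms cyclic_on_inI[OF assms(1)] by (intro cyclic_on_invariant_subset[OF assms(1)]) auto
  moreover have "card {i, c i} \<le> 2" by (cases "c i = i") auto
  ultimately show False using assms(2) by simp
qed

text \<open>A cycle of length at least 3 has exactly two orientations: at each vertex
  \<open>c\<close> must go to one of the two neighbours along \<open>d\<close>, and it cannot change
  direction on the way.\<close>

lemma cycle_edges_eq_iff:
  assumes c: "c permutes C" "cyclic_on c C" and d: "d permutes C" "cyclic_on d C" and "card C \<ge> 3"
  shows "cycle_edges C c = cycle_edges C d \<longleftrightarrow> c = d \<or> c = inv d"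
proof
  assume eq: "cycle_edges C c = cycle_edges C d"
  note dd = permutes_inverses[OF d(1)]
  have alt: "c i = d i \<or> c i = inv d i" if i: "i \<in> C" for i
  proof -
    have "{i, c i} \<in> cycle_edges C d" using eq i by (auto simp: cycle_edges_def)
    then obtain k where "{i, c i} = {k, d k}" by (auto simp: cycle_edges_def)
    then have "c i = d i \<or> i = d (c i)" by (auto simp: doubleton_eq_iff)
    then show ?thesis using dd by metis
  qed
  txt \<open>Once the two cycles agree at one vertex they agree at the next, hence everywhere.\<close>
  define A where "A = {i \<in> C. c i = d i}"
  have inv: "d ` A \<subseteq> A"
  proof
    fix x assume "x \<in> d ` A"
    then obtain i where i: "i \<in> C" "c i = d i" "x = d i" by (auto simp: A_def)
    have x: "x \<in> C" using i permutes_in_image[OF d(1)] by simp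
    have "inv d x = i" using i dd by simp
    \<comment> \<open>If \<open>c x\<close> were \<open>inv d x\<close>, which is \<open>i\<close>,
      then \<open>c\<close> would return to \<open>i\<close> after two steps.\<close>
    moreover have "c (c i) \<noteq> i" using cyclic_on_not_involutive[OF c(2) assms(5) i(1)] .
    ultimately have "c x = d x" using alt[OF x] i by auto
    then show "x \<in> A" using x by (simp add: A_def)
  qed
  show "c = d \<or> c = inv d"
  proof (cases "A = {}")
    case True
    then have "c i = inv d i" for i
      using alt[of i] permutes_not_in[OF c(1), of i] permutes_not_in[OF permutes_inv[OF d(1)], of i]
      by (cases "i \<in> C") (auto simp: A_def)
    then show ?thesis by auto
  next
    case False
    then have "A = C" using inv by (intro cyclic_on_invariant_subset[OF d(2)]) (auto simp: A_def)
    then have "c i = d i" for i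
      using permutes_not_in[OF c(1), of i] permutes_not_in[OF d(1), of i]
      by (cases "i \<in> C") (auto simp: A_def)
    then show ?thesis by auto
  qed
next
  have "cycle_edges C (inv d) = cycle_edges C d"
  proof -
    have "cycle_edges C (inv d) = (\<lambda>i. {i, inv d i}) ` (d ` C)"
      using permutes_image[OF d(1)] by (simp add: cycle_edges_def)
    also have "\<dots> = cycle_edges C d"
      by (simp add: image_image cycle_edges_def permutes_inverses[OF d(1)] insert_commute)
    finally show ?thesis .
  qed
  then show "c = d \<or> c = inv d \<Longrightarrow> cycle_edges C c = cycle_edges C d" by auto
qed

text \<open>The factor 2 counts the two orientations of a cycle.\<close>

lemma sum_rooted_cycles_edges:
  fixes h :: "'a set \<Rightarrow> real"
  assumes fin: "finite V"
  shows "(\<Sum>(C, c)\<in>{(C, c) \<in> rooted_cycles V v. card C \<ge> 3 \<and> cycle_edges C c \<subseteq> E}. h C) =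
    2 * (\<Sum>X | X \<in> cycles_through_vertex E v \<and> \<Union>X \<subseteq> V. h (\<Union>X))"
proof -
  let ?S = "{(C, c) \<in> rooted_cycles V v. card C \<ge> 3 \<and> cycle_edges C c \<subseteq> E}"
  let ?T = "{X. X \<in> cycles_through_vertex E v \<and> \<Union>X \<subseteq> V}"
  let ?e = "\<lambda>(C, c). cycle_edges C c"
  have finS: "finite ?S" by (rule finite_subset[OF _ finite_rooted_cycles[OF fin, of v]]) auto
  have img: "?e ` ?S = ?T"
  proof (intro equalityI subsetI)
    fix X assume "X \<in> ?e ` ?S"
    then obtain C c where "(C, c) \<in> rooted_cycles V v" "card C \<ge> 3" "X \<subseteq> E" "X = cycle_edges C c"
      by auto
    then show "X \<in> ?T"
      using is_cycle_cycle_edges[of C c] Union_cycle_edges[of c C]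
      by (auto simp: cycles_through_vertex_def cycles_def rooted_cycles_def simp del: Union_iff)
  next
    fix X assume X: "X \<in> ?T"
    then obtain C c where c: "card C \<ge> 3" "c permutes C" "cyclic_on c C" "X = cycle_edges C c"
      by (auto simp: cycles_through_vertex_def cycles_def elim: is_cycle_obtain)
    then have "(C, c) \<in> ?S"
      using X Union_cycle_edges[of c C]
      by (auto simp: cycles_through_vertex_def cycles_def rooted_cycles_def simp del: Union_iff)
    then show "X \<in> ?e ` ?S" using c(4) by force
  qed
  have finT: "finite ?T" using finite_imageI[OF finS, of ?e] unfolding img .
  have "(\<Sum>a\<in>?S. h (fst a)) = (\<Sum>X\<in>?T. \<Sum>a\<in>{a \<in> ?S. ?e a = X}. h (fst a))"
    by (rule sum.group[OF finS finT equalityD1[OF img], symmetric])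
  also have "\<dots> = (\<Sum>X\<in>?T. 2 * h (\<Union>X))"
  proof (rule sum.cong[OF refl])
    fix X assume "X \<in> ?T"
    then have "X \<in> ?e ` ?S" unfolding img .
    then obtain D d where D: "(D, d) \<in> ?S" "X = cycle_edges D d" by auto
    then have d: "d permutes D" "cyclic_on d D" "card D \<ge> 3" by (auto simp: rooted_cycles_def)
    have finD: "finite D" using d(2) by (rule finite_cyclic_on)
    have UX: "\<Union>X = D" using D(2) Union_cycle_edges[OF d(1)] by simp
    have ne: "d \<noteq> inv d"
    proof
      assume "d = inv d"
      then have "d (d i) = i" for i using permutes_inverses(1)[OF d(1), of i] by simp
      then show False using cyclic_on_not_involutive[OF d(2,3)] d(2) by (auto simp: cyclic_on_def)
    qed
    have "{a \<in> ?S. ?e a = X} = {(D, d), (D, inv d)}"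
    proof (intro equalityI subsetI)
      fix a assume "a \<in> {a \<in> ?S. ?e a = X}"
      then obtain C c where a: "a = (C, c)" "(C, c) \<in> ?S" "cycle_edges C c = X" by auto
      then have c: "c permutes C" "cyclic_on c C" by (auto simp: rooted_cycles_def)
      have "C = D" using Union_cycle_edges[OF c(1)] a(3) UX by simp
      then show "a \<in> {(D, d), (D, inv d)}"
        using cycle_edges_eq_iff[of c D d] c d a D(2) by auto
    next
      fix a assume "a \<in> {(D, d), (D, inv d)}"
      moreover have "cycle_edges D (inv d) = cycle_edges D d"
        using cycle_edges_eq_iff[of "inv d" D d] d permutes_inv[OF d(1)] cyclic_on_inv[OF finD d(1,2)] by simp
      ultimately show "a \<in> {a \<in> ?S. ?e a = X}"
        using D permutes_inv[OF d(1)] cyclic_on_inv[OF finD d(1,2)] by (auto simp: rooted_cycles_def)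
    qed
    then show "(\<Sum>a\<in>{a \<in> ?S. ?e a = X}. h (fst a)) = 2 * h (\<Union>X)"
      using ne UX by simp
  qed
  finally show ?thesis by (simp add: case_prod_unfold sum_distrib_left)
qed

section \<open>Expansion along a vertex of a graph\<close>

lemma cyclic_on_transpose: "cyclic_on (transpose u v) {u, v}"
proof (rule cyclic_onI_invariant)
  fix A assume "A \<subseteq> {u, v}" "A \<noteq> {}" "transpose u v ` A \<subseteq> A"
  moreover from this have "A = {u} \<or> A = {v} \<or> A = {u, v}" by blast
  ultimately show "A = {u, v}" by auto
qed (auto intro: permutes_swap_id)

lemma rooted_cycles_card_2:
  assumes "v \<in> V"
  shows "{(C, c) \<in> rooted_cycles V v. card C = 2} = (\<lambda>u. ({u, v}, transpose u v)) ` (V - {v})"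
    (is "?L = ?R")
proof (intro equalityI subsetI)
  fix a assume "a \<in> ?L"
  then obtain C c where a: "a = (C, c)" "(C, c) \<in> rooted_cycles V v" "card C = 2" by auto
  then have C: "v \<in> C" "C \<subseteq> V" "c permutes C" by (auto simp: rooted_cycles_def)
  obtain u where u: "C = {u, v}" "u \<noteq> v"
    using a(3) C(1) by (auto simp: card_2_iff)
  have "c u \<noteq> u" using rooted_cycle_no_fixpoint[OF a(2)] a(3) u by auto
  then have "c = transpose u v" using C(3) u by (auto simp: permutes_doubleton_iff)
  then show "a \<in> ?R" using a u C by auto
next
  fix a assume "a \<in> ?R"
  then obtain u where "u \<in> V" "u \<noteq> v" "a = ({u, v}, transpose u v)" by auto
  then show "a \<in> ?L"
    using assms cyclic_on_transpose[of u v] permutes_swap_id[of u "{u, v}" v]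
    by (auto simp: rooted_cycles_def)
qed

text \<open>The diagonal of \<open>M\<close> is left free so that the edge expansion can use a
  matrix with the off-diagonal part of one graph and the diagonal of another. The cycles through
  \<open>v\<close> are sorted by length into 1, 2 and at least 3.\<close>

theorem hook_immanant_graph_expand:
  assumes G: "simple_graph V E" and v: "v \<in> V"
    and M: "\<And>i j. i \<in> V \<Longrightarrow> j \<in> V \<Longrightarrow> i \<noteq> j \<Longrightarrow> M i j = \<gamma> * adjacency_matrix E i j"
  shows "hook_immanant k V M = M v v * cycle_cofactor k V M {v}
    + \<gamma>\<^sup>2 * (\<Sum>u\<in>neighbourhood E v. cycle_cofactor k V M {u, v})
    + 2 * (\<Sum>X\<in>cycles_through_vertex E v. \<gamma> ^ card (\<Union>X) * cycle_cofactor k V M (\<Union>X))"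
proof -
  have fin: "finite V" and E: "\<And>e. e \<in> E \<Longrightarrow> e \<subseteq> V \<and> card e = 2"
    using G by (auto simp: simple_graph_def)
  let ?R = "rooted_cycles V v"
  let ?t = "\<lambda>(C, c). (\<Prod>i\<in>C. M i (c i)) * cycle_cofactor k V M C"
  define R2 where "R2 = {(C, c) \<in> ?R. card C = 2}"
  define R3 where "R3 = {(C, c) \<in> ?R. card C \<ge> 3}"
  have finR: "finite ?R" by (rule finite_rooted_cycles[OF fin])
  have finR23: "finite R2" "finite R3"
    unfolding R2_def R3_def by (rule finite_subset[OF _ finR], auto)+
  have R: "?R = insert ({v}, id) (R2 \<union> R3)"
  proof (intro equalityI subsetI)
    fix a assume a: "a \<in> ?R"
    then obtain C c where C: "a = (C, c)" "v \<in> C" "C \<subseteq> V" by (auto simp: rooted_cycles_def)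
    have "finite C" using C(3) fin by (rule finite_subset)
    then have "card C \<noteq> 0" using C(2) by auto
    then consider "card C = 1" | "card C = 2" | "card C \<ge> 3" by linarith
    then show "a \<in> insert ({v}, id) (R2 \<union> R3)"
      using rooted_cycle_card_1[of C c V v] a C(1) by cases (auto simp: R2_def R3_def)
  qed (use singleton_in_rooted_cycles[OF v] in \<open>auto simp: R2_def R3_def\<close>)
  have "hook_immanant k V M = sum ?t ?R" by (rule hook_immanant_expand[OF fin v])
  also have "\<dots> = M v v * cycle_cofactor k V M {v} + (sum ?t R2 + sum ?t R3)"
  proof -
    have "({v}, id) \<notin> R2 \<union> R3" "R2 \<inter> R3 = {}" by (auto simp: R2_def R3_def)
    then show ?thesis unfolding R using finR23 by (simp add: sum.union_disjoint)
  qed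
  also have "sum ?t R2 = \<gamma>\<^sup>2 * (\<Sum>u\<in>neighbourhood E v. cycle_cofactor k V M {u, v})"
  proof -
    have nb: "neighbourhood E v \<subseteq> V - {v}" using E by (fastforce simp: neighbourhood_def)
    have inj: "inj_on (\<lambda>u. ({u, v}, transpose u v)) (V - {v})"
      by (auto simp: inj_on_def doubleton_eq_iff)
    have "sum ?t R2 = (\<Sum>u\<in>V - {v}. ?t ({u, v}, transpose u v))"
      unfolding R2_def rooted_cycles_card_2[OF v] by (subst sum.reindex[OF inj]) simp
    \<comment> \<open>The transposition of \<open>u\<close> and \<open>v\<close> has weight
      \<open>M u v\<close> times \<open>M v u\<close>, and both entries are \<open>\<gamma>\<close>
      for an edge and 0 otherwise.\<close>
    also have "\<dots> = (\<Sum>u\<in>V - {v}. if u \<in> neighbourhood E v then \<gamma>\<^sup>2 * cycle_cofactor k V M {u, v} else 0)"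
      using v M by (intro sum.cong)
        (auto simp: adjacency_matrix_def neighbourhood_def insert_commute power2_eq_square)
    also have "\<dots> = (\<Sum>u\<in>neighbourhood E v. \<gamma>\<^sup>2 * cycle_cofactor k V M {u, v})"
      using nb fin by (intro sum.mono_neutral_cong_right) auto
    finally show ?thesis by (simp add: sum_distrib_left)
  qed
  also have "sum ?t R3 = 2 * (\<Sum>X\<in>cycles_through_vertex E v. \<gamma> ^ card (\<Union>X) * cycle_cofactor k V M (\<Union>X))"
  proof -
    let ?S = "{(C, c) \<in> ?R. card C \<ge> 3 \<and> cycle_edges C c \<subseteq> E}"
    \<comment> \<open>A single missing edge makes a factor 0, so only permutations that trace a
      cycle of the graph contribute.\<close>
    have w: "(\<Prod>i\<in>C. M i (c i)) = (if cycle_edges C c \<subseteq> E then \<gamma> ^ card C else 0)"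
      if "(C, c) \<in> R3" for C c
    proof -
      have C: "C \<subseteq> V" "c permutes C" "(C, c) \<in> ?R" "(C, c) \<noteq> ({v}, id)" "finite C"
        using that fin finite_subset by (auto simp: R3_def rooted_cycles_def)
      have Mi: "M i (c i) = (if {i, c i} \<in> E then \<gamma> else 0)" if "i \<in> C" for i
      proof -
        have "i \<in> V" "c i \<in> V" using that C(1) permutes_in_image[OF C(2), of i] by auto
        then show ?thesis
          using M[of i "c i"] rooted_cycle_no_fixpoint[OF C(3,4) that] by (simp add: adjacency_matrix_def)
      qed
      show ?thesis
      proof (cases "cycle_edges C c \<subseteq> E")
        case True
        then have "(\<Prod>i\<in>C. M i (c i)) = (\<Prod>i\<in>C. \<gamma>)"
          using Mi by (intro prod.cong) (auto simp: cycle_edges_def)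
        then show ?thesis using True by simp
      next
        case False
        then obtain i where "i \<in> C" "{i, c i} \<notin> E" by (auto simp: cycle_edges_def)
        then have "(\<Prod>i\<in>C. M i (c i)) = 0" using Mi[of i] C(5) by (intro prod_zero) auto
        then show ?thesis using False by simp
      qed
    qed
    have "sum ?t R3 = (\<Sum>(C, c)\<in>?S. \<gamma> ^ card C * cycle_cofactor k V M C)"
      by (rule sum.mono_neutral_cong_right[OF finR23(2)]) (use w in \<open>auto simp: R3_def split: if_splits\<close>)
    also have "\<dots> = 2 * (\<Sum>X | X \<in> cycles_through_vertex E v \<and> \<Union>X \<subseteq> V.
        \<gamma> ^ card (\<Union>X) * cycle_cofactor k V M (\<Union>X))"
      by (rule sum_rooted_cycles_edges[OF fin])
    also have "{X. X \<in> cycles_through_vertex E v \<and> \<Union>X \<subseteq> V} = cycles_through_vertex E v"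
      using E by (fastforce simp: cycles_through_vertex_def cycles_def)
    finally show ?thesis .
  qed
  finally show ?thesis by simp
qed

section \<open>Graph matrices\<close>

lemma H_matrix_offdiagonal: "i \<noteq> j \<Longrightarrow> H_matrix \<beta> \<gamma> E i j = \<gamma> * adjacency_matrix E i j"
  by (simp add: H_matrix_def degree_matrix_def)

lemma H_matrix_diagonal:
  assumes "simple_graph V E"
  shows "H_matrix \<beta> \<gamma> E i i = \<beta> * real (degree E i)"
proof -
  have "{i} \<notin> E" using assms by (auto simp: simple_graph_def)
  then show ?thesis by (simp add: H_matrix_def degree_matrix_def adjacency_matrix_def)
qed

lemma cycle_cofactor_doubleton:
  "u \<noteq> v \<Longrightarrow> cycle_cofactor k I M {u, v} =
    hook_immanant (k - 2) (I - {u, v}) M - hook_immanant k (I - {u, v}) M"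
  by (simp add: cycle_cofactor_def)

lemma finite_neighbourhood:
  assumes "simple_graph V E"
  shows "finite (neighbourhood E v)"
proof (rule finite_subset)
  show "neighbourhood E v \<subseteq> V" using assms by (auto simp: simple_graph_def neighbourhood_def)
  show "finite V" using assms by (simp add: simple_graph_def)
qed

lemma neighbourhood_delete_edge:
  assumes "{u, v} \<in> E"
  shows "neighbourhood E v = insert u (neighbourhood (E - {{u, v}}) v)"
    and "u \<notin> neighbourhood (E - {{u, v}}) v"
  using assms by (auto simp: neighbourhood_def doubleton_eq_iff)

section \<open>The vertex and edge expansions\<close>

lemma hook_immanant_vertex_expansion:
  assumes G: "simple_graph V E" and v: "v \<in> V"
  shows "hook_immanant k V (H_matrix \<beta> \<gamma> E) =
        \<beta> * real (degree E v) *
          (hook_immanant (k - 1) (V - {v}) (H_matrix \<beta> \<gamma> E)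
           + hook_immanant k (V - {v}) (H_matrix \<beta> \<gamma> E))
      + \<gamma>\<^sup>2 * (\<Sum>u\<in>neighbourhood E v.
          hook_immanant (k - 2) (V - {u, v}) (H_matrix \<beta> \<gamma> E)
          - hook_immanant k (V - {u, v}) (H_matrix \<beta> \<gamma> E))
      + 2 * (\<Sum>C\<in>cycles_through_vertex E v. \<gamma> ^ card (\<Union>C) *
          (hook_immanant (k - int (card (\<Union>C))) (V - \<Union>C) (H_matrix \<beta> \<gamma> E)
           - (-1) ^ card (\<Union>C) * hook_immanant k (V - \<Union>C) (H_matrix \<beta> \<gamma> E)))"
proof -
  let ?H = "H_matrix \<beta> \<gamma> E"
  have "v \<notin> neighbourhood E v" using G by (auto simp: neighbourhood_def simple_graph_def)
  then have "(\<Sum>u\<in>neighbourhood E v. cycle_cofactor k V ?H {u, v}) = (\<Sum>u\<in>neighbourhood E v.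
      hook_immanant (k - 2) (V - {u, v}) ?H - hook_immanant k (V - {u, v}) ?H)"
    by (intro sum.cong refl cycle_cofactor_doubleton) auto
  moreover have "hook_immanant k V ?H = ?H v v * cycle_cofactor k V ?H {v}
    + \<gamma>\<^sup>2 * (\<Sum>u\<in>neighbourhood E v. cycle_cofactor k V ?H {u, v})
    + 2 * (\<Sum>X\<in>cycles_through_vertex E v. \<gamma> ^ card (\<Union>X) * cycle_cofactor k V ?H (\<Union>X))"
    by (rule hook_immanant_graph_expand[OF G v]) (rule H_matrix_offdiagonal)
  ultimately show ?thesis
    by (simp only: cycle_cofactor_singleton H_matrix_diagonal[OF G]) (simp only: cycle_cofactor_def)
qed

lemma hook_immanant_edge_expansion:
  assumes G: "simple_graph V E" and e: "{u, v} \<in> E"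
  shows "hook_immanant k V (H_matrix \<beta> \<gamma> E) =
        hook_immanant k V (H_matrix \<beta> \<gamma> (E - {{u, v}}))
      + \<beta> * (hook_immanant k (V - {v}) (H_matrix \<beta> \<gamma> (E - {{u, v}}))
             + hook_immanant (k - 1) (V - {v}) (H_matrix \<beta> \<gamma> (E - {{u, v}})))
      + \<beta> * (hook_immanant k (V - {u}) (H_matrix \<beta> \<gamma> (E - {{u, v}}))
             + hook_immanant (k - 1) (V - {u}) (H_matrix \<beta> \<gamma> (E - {{u, v}})))
      + ((\<beta>\<^sup>2 - \<gamma>\<^sup>2) * hook_immanant k (V - {u, v}) (H_matrix \<beta> \<gamma> E)
         + 2 * \<beta>\<^sup>2 * hook_immanant (k - 1) (V - {u, v}) (H_matrix \<beta> \<gamma> E)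
         + (\<beta>\<^sup>2 + \<gamma>\<^sup>2) * hook_immanant (k - 2) (V - {u, v}) (H_matrix \<beta> \<gamma> E))
      + 2 * (\<Sum>C\<in>cycles_through_edge E {u, v}. \<gamma> ^ card (\<Union>C) *
          (hook_immanant (k - int (card (\<Union>C))) (V - \<Union>C) (H_matrix \<beta> \<gamma> E)
           - (-1) ^ card (\<Union>C) * hook_immanant k (V - \<Union>C) (H_matrix \<beta> \<gamma> E)))"
proof -
  let ?e = "{u, v}"
  let ?E = "E - {?e}"
  let ?H = "H_matrix \<beta> \<gamma> E" and ?H' = "H_matrix \<beta> \<gamma> ?E"
  have G': "simple_graph V ?E" using G by (auto simp: simple_graph_def)
  have uv: "u \<in> V" "v \<in> V" "u \<noteq> v" and fin: "finite V"
    using G e by (auto simp: simple_graph_def)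
  have off: "?H i j = \<gamma> * adjacency_matrix E i j" "?H' i j = \<gamma> * adjacency_matrix ?E i j"
    if "i \<noteq> j" for i j using that by (simp_all add: H_matrix_offdiagonal)
  have off_eq: "?H i j = ?H' i j" if "i \<noteq> j" "{i, j} \<noteq> ?e" for i j
    using that off[OF that(1)] by (simp add: adjacency_matrix_def)
  have diag_eq: "?H i i = ?H' i i" if "i \<noteq> u" "i \<noteq> v" for i
  proof -
    have "neighbourhood E i = neighbourhood ?E i"
      using that by (auto simp: neighbourhood_def doubleton_eq_iff)
    then show ?thesis by (simp add: H_matrix_diagonal[OF G] H_matrix_diagonal[OF G'] degree_def)
  qed
  \<comment> \<open>Deleting the edge lowers the degree of each of its ends by one.\<close>
  have diag_v: "?H v v - ?H' v v = \<beta>"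
    using neighbourhood_delete_edge[OF e] finite_neighbourhood[OF G', of v]
    by (simp add: H_matrix_diagonal[OF G] H_matrix_diagonal[OF G'] degree_def algebra_simps)
  have diag_u: "?H u u - ?H' u u = \<beta>"
    using neighbourhood_delete_edge[of v u E] e finite_neighbourhood[OF G', of u]
    by (simp add: H_matrix_diagonal[OF G] H_matrix_diagonal[OF G'] degree_def algebra_simps insert_commute)
  txt \<open>
    \<open>H(G - e)\<close> is reached from \<open>H(G)\<close> by lowering the diagonal entry at \<open>u\<close>, which gives \<open>N1\<close>, then
    the one at \<open>v\<close>, which gives \<open>N\<close>, and finally by clearing the entries at \<open>(u, v)\<close> and \<open>(v, u)\<close>.
  \<close>
  define N where "N = (\<lambda>i j. if i = j then ?H' i j else ?H i j)"
  define N1 where "N1 = (\<lambda>i j. if i = v \<and> j = v then ?H v v else N i j)"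
  have uv_eq: "hook_immanant j (V - {u, v}) ?H' = hook_immanant j (V - {u, v}) ?H" for j
  proof (rule hook_immanant_cong)
    fix i j assume "i \<in> V - {u, v}" "j \<in> V - {u, v}"
    then show "?H' i j = ?H i j" using off_eq[of i j] diag_eq[of i] by (cases "i = j") (auto simp: doubleton_eq_iff)
  qed

  have change_u: "hook_immanant k V ?H = hook_immanant k V N1 +
      \<beta> * (hook_immanant (k - 1) (V - {u}) ?H + hook_immanant k (V - {u}) ?H)"
  proof -
    have "hook_immanant k V ?H = hook_immanant k V N1 + (?H u u - N1 u u) *
      (hook_immanant (k - 1) (V - {u}) N1 + hook_immanant k (V - {u}) N1)"
      using diag_eq by (intro hook_immanant_change_diagonal[OF fin uv(1)]) (auto simp: N1_def N_def)
    moreover have "?H u u - N1 u u = \<beta>" using diag_u uv by (simp add: N1_def N_def)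
    moreover have "hook_immanant j (V - {u}) N1 = hook_immanant j (V - {u}) ?H" for j
      using diag_eq by (intro hook_immanant_cong) (auto simp: N1_def N_def)
    ultimately show ?thesis by simp
  qed
  \<comment> \<open>The minors in \<open>change_u\<close> still carry the larger diagonal entry at
    \<open>v\<close>. Lowering it there, for \<open>j = k\<close> and \<open>j = k - 1\<close>,
    produces the \<open>\<beta>\<^sup>2\<close> terms, with coefficients 1, 2, 1 at indices
    \<open>k\<close>, \<open>k - 1\<close>, \<open>k - 2\<close>.\<close>
  have change_uv: "hook_immanant j (V - {u}) ?H = hook_immanant j (V - {u}) ?H' +
      \<beta> * (hook_immanant (j - 1) (V - {u, v}) ?H + hook_immanant j (V - {u, v}) ?H)" for j
  proof -
    have "hook_immanant j (V - {u}) ?H = hook_immanant j (V - {u}) ?H' + (?H v v - ?H' v v) *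
      (hook_immanant (j - 1) (V - {u} - {v}) ?H' + hook_immanant j (V - {u} - {v}) ?H')"
    proof (rule hook_immanant_change_diagonal)
      fix i l assume "i \<in> V - {u}" "l \<in> V - {u}" "(i, l) \<noteq> (v, v)"
      then show "?H i l = ?H' i l" using off_eq[of i l] diag_eq[of i] by (cases "i = l") (auto simp: doubleton_eq_iff)
    qed (use fin uv in auto)
    moreover have "V - {u} - {v} = V - {u, v}" by auto
    ultimately show ?thesis using diag_v by (simp add: uv_eq)
  qed
  have change_v: "hook_immanant k V N1 = hook_immanant k V N +
      \<beta> * (hook_immanant (k - 1) (V - {v}) ?H' + hook_immanant k (V - {v}) ?H')"
  proof -
    have "hook_immanant k V N1 = hook_immanant k V N + (N1 v v - N v v) *
      (hook_immanant (k - 1) (V - {v}) N + hook_immanant k (V - {v}) N)"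
      by (intro hook_immanant_change_diagonal[OF fin uv(2)]) (auto simp: N1_def)
    moreover have "N1 v v - N v v = \<beta>" using diag_v by (simp add: N1_def N_def)
    moreover have "hook_immanant j (V - {v}) N = hook_immanant j (V - {v}) ?H'" for j
      using off_eq by (intro hook_immanant_cong) (auto simp: N_def doubleton_eq_iff)
    ultimately show ?thesis by simp
  qed

  \<comment> \<open>\<open>N\<close> and \<open>?H'\<close> can differ only at \<open>(u, v)\<close>
    and \<open>(v, u)\<close>, and both entries disappear once \<open>v\<close> is deleted.\<close>
  have cof_N: "cycle_cofactor k V N C = cycle_cofactor k V ?H' C" if "v \<in> C" for C
    using that off_eq by (intro cycle_cofactor_cong) (auto simp: N_def doubleton_eq_iff)
  have cof_H: "cycle_cofactor k V ?H' C = cycle_cofactor k V ?H C" if "u \<in> C" "v \<in> C" for C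
  proof (rule cycle_cofactor_cong)
    fix i j assume "i \<in> V - C" "j \<in> V - C"
    then have "i \<noteq> u" "i \<noteq> v" "j \<noteq> u" "j \<noteq> v" using that by auto
    then show "?H' i j = ?H i j"
      using off_eq[of i j] diag_eq[of i] by (cases "i = j") (auto simp: doubleton_eq_iff)
  qed
  let ?h = "\<lambda>X. \<gamma> ^ card (\<Union>X) * cycle_cofactor k V ?H' (\<Union>X)"
  \<comment> \<open>The off-diagonal entries of \<open>N\<close> come from \<open>E\<close>, so the
    sums run over neighbours and cycles in \<open>E\<close>, while the diagonal entry and the
    cofactors are those of \<open>?H'\<close>.\<close>
  have expand_N: "hook_immanant k V N = ?H' v v * cycle_cofactor k V ?H' {v}
    + \<gamma>\<^sup>2 * (\<Sum>w\<in>neighbourhood E v. cycle_cofactor k V ?H' {w, v})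
    + 2 * (\<Sum>X\<in>cycles_through_vertex E v. ?h X)"
  proof -
    have "hook_immanant k V N = N v v * cycle_cofactor k V N {v}
      + \<gamma>\<^sup>2 * (\<Sum>w\<in>neighbourhood E v. cycle_cofactor k V N {w, v})
      + 2 * (\<Sum>X\<in>cycles_through_vertex E v. \<gamma> ^ card (\<Union>X) * cycle_cofactor k V N (\<Union>X))"
      by (rule hook_immanant_graph_expand[OF G uv(2)]) (simp add: N_def off)
    moreover have "(\<Sum>X\<in>cycles_through_vertex E v. \<gamma> ^ card (\<Union>X) * cycle_cofactor k V N (\<Union>X))
        = (\<Sum>X\<in>cycles_through_vertex E v. ?h X)"
      by (intro sum.cong refl) (subst cof_N, auto simp: cycles_through_vertex_def)
    ultimately show ?thesis by (simp add: cof_N) (simp add: N_def)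
  qed
  have expand_H': "hook_immanant k V ?H' = ?H' v v * cycle_cofactor k V ?H' {v}
    + \<gamma>\<^sup>2 * (\<Sum>w\<in>neighbourhood ?E v. cycle_cofactor k V ?H' {w, v})
    + 2 * (\<Sum>X\<in>cycles_through_vertex ?E v. ?h X)"
    by (rule hook_immanant_graph_expand[OF G' uv(2)]) (simp add: off)
  have nb: "(\<Sum>w\<in>neighbourhood E v. cycle_cofactor k V ?H' {w, v}) =
      cycle_cofactor k V ?H {u, v} + (\<Sum>w\<in>neighbourhood ?E v. cycle_cofactor k V ?H' {w, v})"
    unfolding neighbourhood_delete_edge(1)[OF e]
    using finite_neighbourhood[OF G', of v] neighbourhood_delete_edge(2)[OF e] cof_H[of "{u, v}"] by simp
  have cyc: "(\<Sum>X\<in>cycles_through_vertex E v. ?h X) =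
      (\<Sum>X\<in>cycles_through_vertex ?E v. ?h X)
      + (\<Sum>X\<in>cycles_through_edge E ?e. \<gamma> ^ card (\<Union>X) * cycle_cofactor k V ?H (\<Union>X))"
  proof -
    have "E \<subseteq> Pow V" using G by (auto simp: simple_graph_def)
    then have "finite E" using fin by (simp add: finite_subset)
    then have "finite (cycles E)" using finite_subset[of "cycles E" "Pow E"] by (auto simp: cycles_def)
    moreover have "cycles_through_edge E ?e \<subseteq> cycles E" "cycles_through_vertex ?E v \<subseteq> cycles E"
      by (auto simp: cycles_through_edge_def cycles_through_vertex_def cycles_def)
    ultimately have "finite (cycles_through_edge E ?e)" "finite (cycles_through_vertex ?E v)"
      by (simp_all add: finite_subset)
    \<comment> \<open>A cycle through \<open>v\<close> avoids the edge or contains it, and a cycle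
      containing the edge passes through \<open>v\<close>.\<close>
    moreover have "cycles_through_vertex E v = cycles_through_vertex ?E v \<union> cycles_through_edge E ?e"
      by (auto simp: cycles_through_vertex_def cycles_through_edge_def cycles_def)
    moreover have "cycles_through_vertex ?E v \<inter> cycles_through_edge E ?e = {}"
      by (auto simp: cycles_through_vertex_def cycles_through_edge_def cycles_def)
    ultimately have "(\<Sum>X\<in>cycles_through_vertex E v. ?h X) =
        (\<Sum>X\<in>cycles_through_vertex ?E v. ?h X) + (\<Sum>X\<in>cycles_through_edge E ?e. ?h X)"
      by (simp add: sum.union_disjoint)
    also have "(\<Sum>X\<in>cycles_through_edge E ?e. ?h X) =
        (\<Sum>X\<in>cycles_through_edge E ?e. \<gamma> ^ card (\<Union>X) * cycle_cofactor k V ?H (\<Union>X))"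
      by (intro sum.cong refl) (subst cof_H, auto simp: cycles_through_edge_def)
    finally show ?thesis .
  qed
  \<comment> \<open>Comparing the two expansions along \<open>v\<close>, the diagonal terms agree;
    what is left is the neighbour \<open>u\<close> and the cycles through the edge.\<close>
  have N: "hook_immanant k V N = hook_immanant k V ?H' + \<gamma>\<^sup>2 * cycle_cofactor k V ?H {u, v}
    + 2 * (\<Sum>X\<in>cycles_through_edge E ?e. \<gamma> ^ card (\<Union>X) * cycle_cofactor k V ?H (\<Union>X))"
    unfolding expand_N expand_H' nb cyc by (simp add: algebra_simps)
  show ?thesis
    unfolding change_u change_v change_uv
      N[unfolded cycle_cofactor_doubleton[OF uv(3)], unfolded cycle_cofactor_def]
    by (simp add: algebra_simps power2_eq_square)
qed

theorem theorem1p4: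
  fixes V :: "'a set" and E :: "'a set set" and \<beta> \<gamma> :: real and k :: int
  assumes "simple_graph V E"
  shows
    "(\<forall>v\<in>V. hook_immanant k V (H_matrix \<beta> \<gamma> E) =
        \<beta> * real (degree E v) *
          (hook_immanant (k - 1) (V - {v}) (H_matrix \<beta> \<gamma> E)
           + hook_immanant k (V - {v}) (H_matrix \<beta> \<gamma> E))
      + \<gamma>\<^sup>2 * (\<Sum>u\<in>neighbourhood E v.
          hook_immanant (k - 2) (V - {u, v}) (H_matrix \<beta> \<gamma> E)
          - hook_immanant k (V - {u, v}) (H_matrix \<beta> \<gamma> E))
      + 2 * (\<Sum>C\<in>cycles_through_vertex E v. \<gamma> ^ card (\<Union>C) *
          (hook_immanant (k - int (card (\<Union>C))) (V - \<Union>C) (H_matrix \<beta> \<gamma> E)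
           - (-1) ^ card (\<Union>C) * hook_immanant k (V - \<Union>C) (H_matrix \<beta> \<gamma> E))))
    \<and>
    (\<forall>u v. {u, v} \<in> E \<longrightarrow> hook_immanant k V (H_matrix \<beta> \<gamma> E) =
        hook_immanant k V (H_matrix \<beta> \<gamma> (E - {{u, v}}))
      + \<beta> * (hook_immanant k (V - {v}) (H_matrix \<beta> \<gamma> (E - {{u, v}}))
             + hook_immanant (k - 1) (V - {v}) (H_matrix \<beta> \<gamma> (E - {{u, v}})))
      + \<beta> * (hook_immanant k (V - {u}) (H_matrix \<beta> \<gamma> (E - {{u, v}}))
             + hook_immanant (k - 1) (V - {u}) (H_matrix \<beta> \<gamma> (E - {{u, v}})))
      + ((\<beta>\<^sup>2 - \<gamma>\<^sup>2) * hook_immanant k (V - {u, v}) (H_matrix \<beta> \<gamma> E)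
         + 2 * \<beta>\<^sup>2 * hook_immanant (k - 1) (V - {u, v}) (H_matrix \<beta> \<gamma> E)
         + (\<beta>\<^sup>2 + \<gamma>\<^sup>2) * hook_immanant (k - 2) (V - {u, v}) (H_matrix \<beta> \<gamma> E))
      + 2 * (\<Sum>C\<in>cycles_through_edge E {u, v}. \<gamma> ^ card (\<Union>C) *
          (hook_immanant (k - int (card (\<Union>C))) (V - \<Union>C) (H_matrix \<beta> \<gamma> E)
           - (-1) ^ card (\<Union>C) * hook_immanant k (V - \<Union>C) (H_matrix \<beta> \<gamma> E))))"
  by (intro conjI ballI allI impI hook_immanant_vertex_expansion[OF assms]
      hook_immanant_edge_expansion[OF assms])

end
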